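(* For every countable ordinal $\alpha$ there is a position in infinite draughts (played with both the forced-jump rule and the forced-iterated-jump rule) whose game value, with Red as the open player, is exactly $\alpha$.
   Context: Infinite draughts is played by two players, Black and Red, on the infinite checkerboard $\mathbb{Z}\times\mathbb{Z}$, using only the dark squares (say those $(x,y)$ with $x+y$ even). A position consists of an arbitrary (possibly infinite) placement of pieces on dark squares, each piece being a black or red pawn or king, together with a specification of which player is to move. Black pawns move only on upward diagonals, red pawns only on downward diagonals; kings may move along all four diagonal directions. A simple move moves a piece one diagonal step, in a permitted direction, to an empty square. A jump moves a piece over a diagonally adjacent enemy piece (in a permitted direction) to the empty square immediately beyond; the jumped enemy piece is captured and removed. A single piece may perform several jumps in succession (an iterated jump), which together count as one turn; different branches of possible jump sequences may be freely chosen. If a piece performs an infinite iterated jump, then all enemy pieces jumped are removed and the jumping piece itself is also removed from the board (infinite-jump rule). There is no promotion of pawns. Forced-jump rule: if a player has any jumping move available, the player must make a jumping move (choosing freely among available jumps). Forced-iterated-jump rule: after a jump, if the same piece can jump again it must do so, continuing until no further jump with that piece is possible (the sequence may be infinite). A player loses when it is their turn and they have no legal move (e.g. no pieces left, or all pieces blocked); the other player then wins. Infinitely long play is a draw. Thus wins occur at finite stages, making the game open for each player. Game values (with respect to a designated "open" player, here Red; the opponent is the "closed" player) are defined by transfinite recursion: (1) a position in which the game is already won for the open player has value $0$; (2) if the game is not yet won and it is the open player's turn, and the open player can move to a position having a value, then the value is $\alpha+1$ where $\alpha$ is the least value of a position reachable in one legal move; (3) if it is the closed player's turn and every position reachable by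 a legal move has a value, then the value is the supremum of those values; otherwise the value is undefined. A position with no value assigned is unvalued. *)

theory Defs
  imports Main "HOL-Library.Countable_Set"
begin

datatype color = Black | Red
datatype kind = Pawn | King

type_synonym piece = "color \<times> kind"
type_synonym sq = "int \<times> int"
type_synonym board = "sq \<Rightarrow> piece option"
text \<open>A position: a placement of pieces together with the player to move.\<close>
type_synonym pos = "board \<times> color"

fun other :: "color \<Rightarrow> color" where
  "other Black = Red"
| "other Red = Black"

fun dirs :: "piece \<Rightarrow> sq set" where
  "dirs (Black, Pawn) = {(1,1), (-1,1)}"
| "dirs (Red, Pawn) = {(1,-1), (-1,-1)}"
| "dirs (_, King) = {(1,1), (-1,1), (1,-1), (-1,-1)}"

fun sq_add :: "sq \<Rightarrow> sq \<Rightarrow> int \<Rightarrow> sq" where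
  "sq_add (x, y) (dx, dy) k = (x + k * dx, y + k * dy)"

text \<open>Positions use only dark squares.\<close>
definition valid_pos :: "pos \<Rightarrow> bool" where
  "valid_pos p \<longleftrightarrow> (\<forall>s. fst p s \<noteq> None \<longrightarrow> even (fst s + snd s))"

definition can_jump :: "piece \<Rightarrow> board \<Rightarrow> sq \<Rightarrow> sq \<Rightarrow> bool" where
  "can_jump pc b s d \<longleftrightarrow> d \<in> dirs pc \<and>
     (\<exists>k. b (sq_add s d 1) = Some (other (fst pc), k)) \<and> b (sq_add s d 2) = None"

definition after_jump :: "piece \<Rightarrow> board \<Rightarrow> sq \<Rightarrow> sq \<Rightarrow> board" where
  "after_jump pc b s d = b(s := None, sq_add s d 1 := None, sq_add s d 2 := Some pc)"

inductive jumps :: "piece \<Rightarrow> board \<Rightarrow> sq \<Rightarrow> board \<Rightarrow> sq \<Rightarrow> bool" where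
  refl: "jumps pc b s b s"
| step: "can_jump pc b s d \<Longrightarrow> jumps pc (after_jump pc b s d) (sq_add s d 2) b' s'
          \<Longrightarrow> jumps pc b s b' s'"

text \<open>A finite iterated jump (at least one jump, continued until no further
  jump of that piece is possible: forced-iterated-jump rule).\<close>
definition fin_jump_move :: "pos \<Rightarrow> pos \<Rightarrow> bool" where
  "fin_jump_move p q \<longleftrightarrow> (\<exists>s pc d b' s'. fst p s = Some pc \<and> fst pc = snd p \<and>
     can_jump pc (fst p) s d \<and>
     jumps pc (after_jump pc (fst p) s d) (sq_add s d 2) b' s' \<and>
     (\<forall>d'. \<not> can_jump pc b' s' d') \<and> q = (b', other (snd p)))"

fun jstate :: "piece \<Rightarrow> board \<Rightarrow> sq \<Rightarrow> (nat \<Rightarrow> sq) \<Rightarrow> nat \<Rightarrow> board \<times> sq" where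
  "jstate pc b s ds 0 = (b, s)"
| "jstate pc b s ds (Suc n) =
     (let st = jstate pc b s ds n
      in (after_jump pc (fst st) (snd st) (ds n), sq_add (snd st) (ds n) 2))"

text \<open>An infinite iterated jump: all jumped pieces are removed and the jumping
  piece itself is removed (infinite-jump rule).\<close>
definition inf_jump_move :: "pos \<Rightarrow> pos \<Rightarrow> bool" where
  "inf_jump_move p q \<longleftrightarrow> (\<exists>s pc ds. fst p s = Some pc \<and> fst pc = snd p \<and>
     (\<forall>n. can_jump pc (fst (jstate pc (fst p) s ds n)) (snd (jstate pc (fst p) s ds n)) (ds n)) \<and>
     q = ((\<lambda>t. if t = s \<or> (\<exists>n. t = sq_add (snd (jstate pc (fst p) s ds n)) (ds n) 1)
               then None else fst p t), other (snd p)))"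

definition simple_move :: "pos \<Rightarrow> pos \<Rightarrow> bool" where
  "simple_move p q \<longleftrightarrow> (\<exists>s pc d. fst p s = Some pc \<and> fst pc = snd p \<and> d \<in> dirs pc \<and>
     fst p (sq_add s d 1) = None \<and>
     q = ((fst p)(s := None, sq_add s d 1 := Some pc), other (snd p)))"

definition has_jump :: "pos \<Rightarrow> bool" where
  "has_jump p \<longleftrightarrow> (\<exists>s pc d. fst p s = Some pc \<and> fst pc = snd p \<and> can_jump pc (fst p) s d)"

definition legal_move :: "pos \<Rightarrow> pos \<Rightarrow> bool" where
  "legal_move p q \<longleftrightarrow>
     (if has_jump p then fin_jump_move p q \<or> inf_jump_move p q else simple_move p q)"

text \<open>Red is the open player, Black the closed player. The game is won for Red
  when Black is to move and has no legal move.\<close>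
definition won :: "pos \<Rightarrow> bool" where
  "won p \<longleftrightarrow> snd p = Black \<and> \<not> (\<exists>q. legal_move p q)"

text \<open>Given the sets V gamma of positions with value gamma for gamma < alpha,
  compute the set of positions with value alpha.  Clause (2) (Red to move)
  only refers to values below alpha; clause (3) (Black to move) may refer to
  Red-to-move positions of value alpha, which are computed first.\<close>
definition stage :: "('o::wellorder \<Rightarrow> pos set) \<Rightarrow> 'o \<Rightarrow> pos set" where
  "stage V \<alpha> =
    (let Op = {p. snd p = Red \<and> \<not> won p \<and>
                 (\<exists>\<beta><\<alpha>. (\<forall>\<gamma>. \<beta> < \<gamma> \<longrightarrow> \<alpha> \<le> \<gamma>) \<and>
                    (\<exists>q. legal_move p q \<and> q \<in> V \<beta>) \<and>
                    (\<forall>\<gamma><\<beta>. \<forall>q. legal_move p q \<longrightarrow> q \<notin> V \<gamma>))};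
         W = (\<lambda>\<gamma>. if \<gamma> < \<alpha> then V \<gamma> else if \<gamma> = \<alpha> then Op else {})
     in {p. won p \<and> (\<forall>\<gamma>. \<alpha> \<le> \<gamma>)} \<union> Op \<union>
        {p. snd p = Black \<and> \<not> won p \<and>
            (\<forall>q. legal_move p q \<longrightarrow> (\<exists>\<gamma>\<le>\<alpha>. q \<in> W \<gamma>)) \<and>
            (\<forall>\<delta><\<alpha>. \<not> (\<forall>q. legal_move p q \<longrightarrow> (\<exists>\<gamma>\<le>\<delta>. q \<in> W \<gamma>)))})"

definition value_set :: "'o::wellorder \<Rightarrow> pos set" where
  "value_set = wfrec {(x, y). x < y} stage"

definition has_value :: "pos \<Rightarrow> 'o::wellorder \<Rightarrow> bool" where
  "has_value p \<alpha> \<longleftrightarrow> p \<in> value_set \<alpha>"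

end

theory Submission
  imports Defs
begin

text \<open>
  All pieces are pawns, so in diagonal coordinates a black pawn only moves right or up, and each
  jump sequence is a monotone lattice path. Draw a well-founded tree by giving every node a ray of
  red pieces: horizontal and vertical rays for nodes of even and odd depth. A black runner on the ray
  of \<open>c\<close> jumps along it and may leave at exactly one place for each child \<open>d\<close> of \<open>c\<close>; since
  horizontal and vertical rays live in different parity classes of squares, rays may cross without
  allowing a turn. After leaving, the runner gets stuck and Red's only jump captures it.
  The runner's path has removed a blocker in front of a second black pawn, whose run (again ending in
  its forced capture) changes the other parity and releases the runner on the ray of \<open>d\<close>. So
  the value of the ray of \<open>c\<close> is the supremum of the values of the rays of its children plus 2. A
  runner that never leaves its ray disappears, and then all remaining black pawns are blocked, which
  contributes the value 1. Hence the rays realise the nonzero limit ordinals plus an even number and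
  the odd finite ordinals; the positions in which the second pawn is to run realise the successors
  of these, that is, all other nonzero ordinals.
\<close>

text \<open>The obstacle is parity. In diagonal coordinates a jumping pawn keeps the parities of
  both coordinates, and it captures on squares that differ from its own in exactly one parity.
  Horizontal runners stand on (even, even) squares, vertical runners on (odd, odd) squares, and the
  red pieces of both kinds of rays on (odd, even) squares: a crossing is one shared red piece, and
  turning there would require a piece of a class that no ray contains. For the same reason a runner
  can never empty the landing square that holds up the next runner, which differs in both parities.
  The second pawn of each gadget, the relay pawn, stands on an (even, odd) square and bridges this
  gap: the runner captures a piece in its class, and it captures one in the class of the next
  runner. Each of the two stuck pawns costs Red one move, whence the increment 2. Gadgets occupy
  bands of width 20 indexed by integers, so the tree must be countable; this is where the
  countability of \<alpha> enters.\<close>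

declare split_paired_All [simp del] split_paired_Ex [simp del]

section \<open>Game values\<close>

text \<open>A relation instead of a function, because an arbitrary well-order may have a greatest
  element.\<close>

definition is_succ :: "'o::wellorder \<Rightarrow> 'o \<Rightarrow> bool" where
  "is_succ \<beta> \<alpha> \<longleftrightarrow> \<beta> < \<alpha> \<and> (\<forall>\<gamma>>\<beta>. \<alpha> \<le> \<gamma>)"

lemma legal_move_other: "legal_move p q \<Longrightarrow> snd q = other (snd p)"
  by (auto simp: legal_move_def fin_jump_move_def inf_jump_move_def simple_move_def split: if_splits)

text \<open>\<open>stage V \<alpha>\<close> consults \<open>V\<close> only below \<alpha>, so the
  cut made by \<open>wfrec\<close> has no effect.\<close>

lemma value_set_stage: "value_set \<alpha> = stage value_set \<alpha>"
proof -
  have "value_set \<alpha> = stage (cut value_set {(x, y). x < y} \<alpha>) \<alpha>"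
    unfolding value_set_def by (rule wfrec) (rule wf)
  also have "\<dots> = stage value_set \<alpha>"
  proof -
    have *: "\<beta> < \<alpha> \<Longrightarrow> cut value_set {(x, y). x < y} \<alpha> \<beta> = value_set \<beta>" for \<beta>
      by (simp add: cut_apply)
    have **: "(\<lambda>\<gamma>. if \<gamma> < \<alpha> then cut value_set {(x, y). x < y} \<alpha> \<gamma> else X \<gamma>)
       = (\<lambda>\<gamma>. if \<gamma> < \<alpha> then value_set \<gamma> else X \<gamma>)" for X
      using * by fastforce
    have ***: "(\<exists>\<beta><\<alpha>. P \<beta> \<and> (\<exists>q. legal_move p q \<and> q \<in> cut value_set {(x, y). x < y} \<alpha> \<beta>) \<and>
          (\<forall>\<gamma><\<beta>. \<forall>q. legal_move p q \<longrightarrow> q \<notin> cut value_set {(x, y). x < y} \<alpha> \<gamma>)) \<longleftrightarrow>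
       (\<exists>\<beta><\<alpha>. P \<beta> \<and> (\<exists>q. legal_move p q \<and> q \<in> value_set \<beta>) \<and>
          (\<forall>\<gamma><\<beta>. \<forall>q. legal_move p q \<longrightarrow> q \<notin> value_set \<gamma>))" for P p
      using * order.strict_trans by (metis (no_types, lifting))
    show ?thesis
      unfolding stage_def Let_def ** *** ..
  qed
  finally show ?thesis .
qed

lemma has_value_Red_iff:
  assumes "snd p = Red"
  shows "has_value p \<alpha> \<longleftrightarrow> (\<exists>\<beta>. is_succ \<beta> \<alpha> \<and> (\<exists>q. legal_move p q \<and> has_value q \<beta>) \<and>
     (\<forall>\<gamma><\<beta>. \<forall>q. legal_move p q \<longrightarrow> \<not> has_value q \<gamma>))"
proof -
  have "\<not> won p" using assms by (simp add: won_def)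
  then show ?thesis
    unfolding has_value_def
    by (subst value_set_stage) (auto simp: stage_def assms is_succ_def)
qed

text \<open>Every move of Black leads to a Red position, and \<open>Op\<close> in
  \<open>stage\<close> is exactly the set of Red positions of value \<alpha>. This removes the
  detour by which clause (3) refers to values up to \<alpha> itself.\<close>

lemma has_value_Black_iff:
  assumes "snd p = Black"
  shows "has_value p \<alpha> \<longleftrightarrow> (if won p then \<forall>\<gamma>. \<alpha> \<le> \<gamma> else
     (\<forall>q. legal_move p q \<longrightarrow> (\<exists>\<gamma>\<le>\<alpha>. has_value q \<gamma>)) \<and>
     (\<forall>\<delta><\<alpha>. \<exists>q. legal_move p q \<and> \<not> (\<exists>\<gamma>\<le>\<delta>. has_value q \<gamma>)))"
proof -
  define Op where "Op = {p. snd p = Red \<and> \<not> won p \<and>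
                 (\<exists>\<beta><\<alpha>. (\<forall>\<gamma>. \<beta> < \<gamma> \<longrightarrow> \<alpha> \<le> \<gamma>) \<and>
                    (\<exists>q. legal_move p q \<and> q \<in> value_set \<beta>) \<and>
                    (\<forall>\<gamma><\<beta>. \<forall>q. legal_move p q \<longrightarrow> q \<notin> value_set \<gamma>))}"
  define W where "W = (\<lambda>\<gamma>. if \<gamma> < \<alpha> then value_set \<gamma> else if \<gamma> = \<alpha> then Op else {})"
  have Op: "q \<in> Op \<longleftrightarrow> has_value q \<alpha>" if "snd q = Red" for q
    using that unfolding has_value_Red_iff[OF that]
    by (auto simp: Op_def is_succ_def has_value_def won_def)
  have W: "q \<in> W \<gamma> \<longleftrightarrow> has_value q \<gamma>" if "legal_move p q" "\<gamma> \<le> \<alpha>" for q \<gamma>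
    using that Op[of q] legal_move_other[OF that(1)] assms
    by (auto simp: W_def has_value_def)
  have "has_value p \<alpha> \<longleftrightarrow> p \<in> stage value_set \<alpha>"
    unfolding has_value_def using value_set_stage by (metis (no_types))
  also have "\<dots> \<longleftrightarrow> won p \<and> (\<forall>\<gamma>. \<alpha> \<le> \<gamma>) \<or> p \<in> Op \<or> (\<not> won p \<and>
            (\<forall>q. legal_move p q \<longrightarrow> (\<exists>\<gamma>\<le>\<alpha>. q \<in> W \<gamma>)) \<and>
            (\<forall>\<delta><\<alpha>. \<not> (\<forall>q. legal_move p q \<longrightarrow> (\<exists>\<gamma>\<le>\<delta>. q \<in> W \<gamma>))))"
    unfolding stage_def Let_def Op_def[symmetric] by (simp only: Un_iff mem_Collect_eq assms W_def simp_thms disj_assoc)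
  also have "p \<in> Op \<longleftrightarrow> False" using assms by (simp add: Op_def)
  also have "(\<forall>q. legal_move p q \<longrightarrow> (\<exists>\<gamma>\<le>\<alpha>. q \<in> W \<gamma>)) \<longleftrightarrow>
     (\<forall>q. legal_move p q \<longrightarrow> (\<exists>\<gamma>\<le>\<alpha>. has_value q \<gamma>))"
    using W by blast
  also have "(\<forall>\<delta><\<alpha>. \<not> (\<forall>q. legal_move p q \<longrightarrow> (\<exists>\<gamma>\<le>\<delta>. q \<in> W \<gamma>))) \<longleftrightarrow>
     (\<forall>\<delta><\<alpha>. \<exists>q. legal_move p q \<and> \<not> (\<exists>\<gamma>\<le>\<delta>. has_value q \<gamma>))"
    using W by (meson less_imp_le order_trans)
  finally show ?thesis by auto
qed

lemma has_value_unique: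
  assumes "has_value p \<alpha>" "has_value p \<beta>"
  shows "\<alpha> = \<beta>"
proof (cases "snd p")
  case Red
  then obtain a q where a: "is_succ a \<alpha>" "legal_move p q" "has_value q a"
      "\<And>\<gamma> q. \<gamma> < a \<Longrightarrow> legal_move p q \<Longrightarrow> \<not> has_value q \<gamma>"
    using assms(1) by (auto simp: has_value_Red_iff)
  obtain b q' where b: "is_succ b \<beta>" "legal_move p q'" "has_value q' b"
      "\<And>\<gamma> q. \<gamma> < b \<Longrightarrow> legal_move p q \<Longrightarrow> \<not> has_value q \<gamma>"
    using assms(2) Red by (auto simp: has_value_Red_iff)
  have "a = b" using a b by (metis linorder_neqE)
  then show ?thesis using a(1) b(1) by (auto simp: is_succ_def intro: order.antisym)
next
  case Black
  then show ?thesis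
    using assms unfolding has_value_Black_iff[OF Black]
    by (metis antisym linorder_neqE)
qed

lemma has_value_won: "won p \<Longrightarrow> (\<And>\<gamma>. \<alpha> \<le> \<gamma>) \<Longrightarrow> has_value p \<alpha>"
  using has_value_Black_iff[of p \<alpha>] by (auto simp: won_def)

lemma has_value_succI:
  assumes "snd p = Red" "legal_move p q" "has_value q \<beta>" "is_succ \<beta> \<alpha>"
    and "\<And>\<gamma> q'. legal_move p q' \<Longrightarrow> \<gamma> < \<beta> \<Longrightarrow> \<not> has_value q' \<gamma>"
  shows "has_value p \<alpha>"
  unfolding has_value_Red_iff[OF assms(1)] using assms by blast

text \<open>Uniqueness of values turns a successor of value \<gamma> > \<delta> into one that has no
  value \<le> \<delta>, which is what clause (3) asks for.\<close>

lemma has_value_SupI: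
  assumes "snd p = Black" "legal_move p q0"
    and "\<And>q. legal_move p q \<Longrightarrow> \<exists>\<gamma>\<le>\<alpha>. has_value q \<gamma>"
    and "\<And>\<delta>. \<delta> < \<alpha> \<Longrightarrow> \<exists>q \<gamma>. legal_move p q \<and> \<delta> < \<gamma> \<and> has_value q \<gamma>"
  shows "has_value p \<alpha>"
proof -
  have "\<not> won p" using assms(2) unfolding won_def by blast
  moreover have "\<exists>q. legal_move p q \<and> \<not> (\<exists>\<gamma>\<le>\<delta>. has_value q \<gamma>)" if "\<delta> < \<alpha>" for \<delta>
    using assms(4)[OF that] has_value_unique by (metis leD)
  ultimately show ?thesis using assms by (simp add: has_value_Black_iff)
qed

section \<open>Boards of pawns in diagonal coordinates\<close>

text \<open>In the coordinates \<open>(a, b)\<close> with \<open>x = a - b\<close> and \<open>y = a + b\<close> every pawn moves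
  along one of the two axes, black ones increasing and red ones decreasing the coordinate.\<close>

type_synonym grid = "int \<times> int \<Rightarrow> color option"

fun emb :: "int \<times> int \<Rightarrow> sq" where
  "emb (a, b) = (a - b, a + b)"

definition brd :: "grid \<Rightarrow> board" where
  "brd g = (\<lambda>(x, y). if even (x + y)
     then map_option (\<lambda>c. (c, Pawn)) (g ((x + y) div 2, (y - x) div 2)) else None)"

declare emb.simps [simp del]

fun sg :: "color \<Rightarrow> int" where
  "sg Black = 1"
| "sg Red = -1"

fun mv :: "color \<Rightarrow> bool \<Rightarrow> int \<Rightarrow> int \<times> int \<Rightarrow> int \<times> int" where
  "mv c d k (a, b) = (if d then (a, b + sg c * k) else (a + sg c * k, b))"

definition vec :: "color \<Rightarrow> bool \<Rightarrow> sq" where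
  "vec c d = (if d then (- sg c, sg c) else (sg c, sg c))"

lemma emb_inj: "emb s = emb t \<longleftrightarrow> s = t"
  by (cases s; cases t) (auto simp: emb.simps)

lemma emb_mv: "emb (mv c d k s) = sq_add (emb s) (vec c d) k"
  by (cases s) (auto simp: vec_def emb.simps algebra_simps)

lemma dirs_Pawn: "v \<in> dirs (c, Pawn) \<longleftrightarrow> (\<exists>d. v = vec c d)"
  by (cases c) (auto simp: vec_def)

lemma vec_inj: "vec c d = vec c d' \<longleftrightarrow> d = d'"
  by (cases c) (auto simp: vec_def)

lemma brd_emb: "brd g (emb s) = map_option (\<lambda>c. (c, Pawn)) (g s)"
  by (cases s) (auto simp: brd_def emb.simps)

lemma brd_dark: "brd g t \<noteq> None \<Longrightarrow> \<exists>s. t = emb s"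
proof -
  assume *: "brd g t \<noteq> None"
  obtain x y where t: "t = (x, y)" by (cases t)
  have "even (x + y)" using * by (auto simp: brd_def t split: if_splits)
  then have "t = emb ((x + y) div 2, (y - x) div 2)"
    unfolding t by (auto simp: emb.simps) presburger+
  then show ?thesis ..
qed

lemma brd_SomeE:
  assumes "brd g t = Some pc"
  obtains s c where "t = emb s" "g s = Some c" "pc = (c, Pawn)"
  using assms brd_dark[of g t] by (auto simp: brd_emb)

lemma brd_eqI: "(\<And>s. B (emb s) = map_option (\<lambda>c. (c, Pawn)) (g s)) \<Longrightarrow>
    (\<And>t. B t \<noteq> None \<Longrightarrow> \<exists>s. t = emb s) \<Longrightarrow> B = brd g"
  by (rule ext) (metis brd_dark brd_emb)

lemma brd_upd: "(brd g)(emb s := map_option (\<lambda>c. (c, Pawn)) z) = brd (g(s := z))"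
  by (rule brd_eqI) (auto simp: brd_emb emb_inj brd_dark split: if_splits)

lemma brd_upd_None: "(brd g)(emb s := None) = brd (g(s := None))"
  using brd_upd[of g s None] by simp

lemma brd_upd_Some: "(brd g)(emb s := Some (c, Pawn)) = brd (g(s := Some c))"
  using brd_upd[of g s "Some c"] by simp

lemma valid_brd: "valid_pos (brd g, c)"
  unfolding valid_pos_def fst_conv by (metis (mono_tags, lifting) brd_def case_prod_beta)

section \<open>Pawn runs tested on the board before the run\<close>

definition gstep :: "grid \<Rightarrow> color \<Rightarrow> int \<times> int \<Rightarrow> bool \<Rightarrow> bool" where
  "gstep g c s d \<longleftrightarrow> g (mv c d 1 s) = Some (other c) \<and> g (mv c d 2 s) = None"

lemma can_jump_brd: "can_jump (c, Pawn) (brd g) (emb s) v \<longleftrightarrow> (\<exists>d. v = vec c d \<and> gstep g c s d)"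
  unfolding can_jump_def dirs_Pawn gstep_def
  by (auto simp: emb_mv[symmetric] brd_emb)

lemma after_jump_brd: "after_jump (c, Pawn) (brd g) (emb s) (vec c d) =
    brd (g(s := None, mv c d 1 s := None, mv c d 2 s := Some c))"
  unfolding after_jump_def emb_mv[symmetric] brd_upd_None brd_upd_Some ..

fun wpos :: "color \<Rightarrow> (nat \<Rightarrow> bool) \<Rightarrow> int \<times> int \<Rightarrow> nat \<Rightarrow> int \<times> int" where
  "wpos c ds s 0 = s"
| "wpos c ds s (Suc n) = mv c (ds n) 2 (wpos c ds s n)"

definition wmid :: "color \<Rightarrow> (nat \<Rightarrow> bool) \<Rightarrow> int \<times> int \<Rightarrow> nat \<Rightarrow> int \<times> int" where
  "wmid c ds s n = mv c (ds n) 1 (wpos c ds s n)"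

text \<open>Closed form of the board after \<open>n\<close> jumps. Intermediate landing squares need
  no case: if all jumps satisfy \<open>gstep\<close>, these squares were already empty before the
  run.\<close>

definition gst :: "grid \<Rightarrow> color \<Rightarrow> (nat \<Rightarrow> bool) \<Rightarrow> int \<times> int \<Rightarrow> nat \<Rightarrow> grid" where
  "gst g c ds s n = (\<lambda>x. if x = wpos c ds s n then Some c
      else if x = s \<or> (\<exists>i<n. x = wmid c ds s i) then None else g x)"

definition ginf :: "grid \<Rightarrow> color \<Rightarrow> (nat \<Rightarrow> bool) \<Rightarrow> int \<times> int \<Rightarrow> grid" where
  "ginf g c ds s = (\<lambda>x. if x = s \<or> (\<exists>i. x = wmid c ds s i) then None else g x)"

definition gcanjump :: "grid \<Rightarrow> color \<Rightarrow> bool" where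
  "gcanjump g c \<longleftrightarrow> (\<exists>s d. g s = Some c \<and> gstep g c s d)"

text \<open>As pawn moves are monotone, a jumping pawn never returns to squares changed by its own
  run, so all jumps of a run may be tested on the board before the run.\<close>

definition gfin :: "grid \<Rightarrow> color \<Rightarrow> grid \<Rightarrow> bool" where
  "gfin g c g' \<longleftrightarrow> (\<exists>s ds n. g s = Some c \<and> 0 < n \<and> (\<forall>i<n. gstep g c (wpos c ds s i) (ds i)) \<and>
     (\<forall>d. \<not> gstep g c (wpos c ds s n) d) \<and> g' = gst g c ds s n)"

definition ginfm :: "grid \<Rightarrow> color \<Rightarrow> grid \<Rightarrow> bool" where
  "ginfm g c g' \<longleftrightarrow> (\<exists>s ds. g s = Some c \<and> (\<forall>i. gstep g c (wpos c ds s i) (ds i)) \<and>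
     g' = ginf g c ds s)"

definition gsimple :: "grid \<Rightarrow> color \<Rightarrow> grid \<Rightarrow> bool" where
  "gsimple g c g' \<longleftrightarrow> (\<exists>s d. g s = Some c \<and> g (mv c d 1 s) = None \<and>
     g' = g(s := None, mv c d 1 s := Some c))"

definition gmove :: "grid \<Rightarrow> color \<Rightarrow> grid \<Rightarrow> bool" where
  "gmove g c g' \<longleftrightarrow> (if gcanjump g c then gfin g c g' \<or> ginfm g c g' else gsimple g c g')"

text \<open>Progress of a pawn of color \<open>c\<close>. Every jump increases it, so it separates
  the squares met during one run.\<close>

definition pot :: "color \<Rightarrow> int \<times> int \<Rightarrow> int" where
  "pot c s = sg c * (fst s + snd s)"


lemma pot_mv: "pot c (mv c d k s) = pot c s + k"
  by (cases s; cases c) (auto simp: pot_def)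

lemma pot_wpos: "pot c (wpos c ds s n) = pot c s + 2 * int n"
  by (induction n) (auto simp: pot_mv)

lemma pot_wmid: "pot c (wmid c ds s n) = pot c s + 2 * int n + 1"
  by (auto simp: wmid_def pot_mv pot_wpos)

lemma gst_ahead: "k > 0 \<Longrightarrow> gst g c ds s n (mv c d k (wpos c ds s n)) = g (mv c d k (wpos c ds s n))"
proof -
  assume "k > 0"
  let ?x = "mv c d k (wpos c ds s n)"
  have p: "pot c ?x = pot c s + 2 * int n + k" by (simp add: pot_mv pot_wpos)
  have "?x \<noteq> wpos c ds s n" using p pot_wpos[of c ds s n] \<open>k > 0\<close> by auto
  moreover have "?x \<noteq> s" using p \<open>k > 0\<close> by auto
  moreover have "?x \<noteq> wmid c ds s i" if "i < n" for i
    using p pot_wmid[of c ds s i] \<open>k > 0\<close> that by auto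
  ultimately show ?thesis by (auto simp: gst_def)
qed

lemma gstep_gst: "gstep (gst g c ds s n) c (wpos c ds s n) d \<longleftrightarrow> gstep g c (wpos c ds s n) d"
  by (simp add: gstep_def gst_ahead)

lemma gst_0: "g s = Some c \<Longrightarrow> gst g c ds s 0 = g"
  by (auto simp: gst_def)

lemma gst_Suc:
  assumes "\<And>i. i < n \<Longrightarrow> gstep g c (wpos c ds s i) (ds i)"
  shows "(gst g c ds s n)(wpos c ds s n := None, wmid c ds s n := None, wpos c ds s (Suc n) := Some c)
    = gst g c ds s (Suc n)"
proof -
  have "wpos c ds s n = s \<or> g (wpos c ds s n) = None"
  proof (cases n)
    case (Suc m)
    then show ?thesis using assms[of m] by (auto simp: gstep_def)
  qed auto
  then show ?thesis
    by (auto simp: gst_def less_Suc_eq fun_eq_iff)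
qed

section \<open>Legal moves of the game as moves on grids\<close>

lemma jstate_brd:
  assumes "g s = Some c" "\<And>i. i < n \<Longrightarrow> gstep g c (wpos c ds s i) (ds i)"
  shows "jstate (c, Pawn) (brd g) (emb s) (\<lambda>i. vec c (ds i)) n =
    (brd (gst g c ds s n), emb (wpos c ds s n))"
  using assms(2)
proof (induction n)
  case 0
  then show ?case using assms(1) by (simp add: gst_0)
next
  case (Suc n)
  then have IH: "jstate (c, Pawn) (brd g) (emb s) (\<lambda>i. vec c (ds i)) n =
    (brd (gst g c ds s n), emb (wpos c ds s n))" by simp
  have "(gst g c ds s n)(wpos c ds s n := None, wmid c ds s n := None, wpos c ds s (Suc n) := Some c)
    = gst g c ds s (Suc n)"
    using Suc.prems by (intro gst_Suc) auto
  then show ?case by (simp add: IH after_jump_brd emb_mv wmid_def)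
qed

lemma jstate_cong: "(\<And>i. i < n \<Longrightarrow> ds i = ds' i) \<Longrightarrow> jstate pc b s ds n = jstate pc b s ds' n"
  by (induction n) auto

text \<open>\<open>jumps\<close> peels off the first jump whereas \<open>jstate\<close> appends the
  last one; the shift translates between them.\<close>

lemma jstate_shift: "jstate pc b s (case_nat d ds) (Suc n) =
    jstate pc (after_jump pc b s d) (sq_add s d 2) ds n"
  by (induction n) (auto simp: Let_def)

lemma jumps_iff_jstate: "jumps pc b s b' s' \<longleftrightarrow> (\<exists>ds n. jstate pc b s ds n = (b', s') \<and>
    (\<forall>i<n. can_jump pc (fst (jstate pc b s ds i)) (snd (jstate pc b s ds i)) (ds i)))"
    (is "_ \<longleftrightarrow> ?R b s")
proof
  show "jumps pc b s b' s' \<Longrightarrow> ?R b s"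
  proof (induction rule: jumps.induct)
    case (refl pc b s)
    have "jstate pc b s (\<lambda>_. (0, 0)) 0 = (b, s)" by simp
    then show ?case by (metis not_less0)
  next
    case (step pc b s d b' s')
    then obtain ds n where *: "jstate pc (after_jump pc b s d) (sq_add s d 2) ds n = (b', s')"
      "\<And>i. i < n \<Longrightarrow> can_jump pc (fst (jstate pc (after_jump pc b s d) (sq_add s d 2) ds i))
         (snd (jstate pc (after_jump pc b s d) (sq_add s d 2) ds i)) (ds i)" by blast
    have "can_jump pc (fst (jstate pc b s (case_nat d ds) i))
         (snd (jstate pc b s (case_nat d ds) i)) (case_nat d ds i)" if "i < Suc n" for i
    proof (cases i)
      case 0
      then show ?thesis using step by simp
    next
      case (Suc j)
      then show ?thesis using *(2)[of j] that unfolding Suc jstate_shift by simp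
    qed
    moreover have "jstate pc b s (case_nat d ds) (Suc n) = (b', s')"
      using *(1) unfolding jstate_shift .
    ultimately show ?case by blast
  qed
next
  have "(\<forall>i<n. can_jump pc (fst (jstate pc b s ds i)) (snd (jstate pc b s ds i)) (ds i)) \<Longrightarrow>
     jumps pc b s (fst (jstate pc b s ds n)) (snd (jstate pc b s ds n))" for ds n
  proof (induction n arbitrary: b s ds)
    case 0
    then show ?case by (simp add: jumps.refl)
  next
    case (Suc n)
    define d ds' where "d = ds 0" and "ds' = (\<lambda>i. ds (Suc i))"
    have ds: "ds = case_nat d ds'"
      by (auto simp: d_def ds'_def split: nat.split)
    have "can_jump pc b s d" using Suc.prems[rule_format, of 0] by (simp add: d_def)
    moreover have "jumps pc (after_jump pc b s d) (sq_add s d 2) (fst (jstate pc b s ds (Suc n)))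
        (snd (jstate pc b s ds (Suc n)))"
      unfolding ds jstate_shift
    proof (rule Suc.IH, intro allI impI)
      fix i assume "i < n"
      then show "can_jump pc (fst (jstate pc (after_jump pc b s d) (sq_add s d 2) ds' i))
          (snd (jstate pc (after_jump pc b s d) (sq_add s d 2) ds' i)) (ds' i)"
        using Suc.prems[rule_format, of "Suc i"] unfolding ds jstate_shift by simp
    qed
    ultimately show ?case by (rule jumps.step)
  qed
  then show "?R b s \<Longrightarrow> jumps pc b s b' s'" by (metis fst_conv snd_conv)
qed

lemma fin_jump_move_iff: "fin_jump_move p q \<longleftrightarrow> (\<exists>s pc ds n. fst p s = Some pc \<and> fst pc = snd p \<and>
    0 < n \<and> (\<forall>i<n. can_jump pc (fst (jstate pc (fst p) s ds i)) (snd (jstate pc (fst p) s ds i)) (ds i)) \<and>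
    (\<forall>d. \<not> can_jump pc (fst (jstate pc (fst p) s ds n)) (snd (jstate pc (fst p) s ds n)) d) \<and>
    q = (fst (jstate pc (fst p) s ds n), other (snd p)))" (is "_ \<longleftrightarrow> ?R")
proof
  assume "fin_jump_move p q"
  then obtain s pc d b' s' where 1: "fst p s = Some pc" "fst pc = snd p"
     "can_jump pc (fst p) s d" "jumps pc (after_jump pc (fst p) s d) (sq_add s d 2) b' s'"
     "\<forall>d'. \<not> can_jump pc b' s' d'" "q = (b', other (snd p))"
    unfolding fin_jump_move_def by blast
  then obtain ds n where 2: "jstate pc (after_jump pc (fst p) s d) (sq_add s d 2) ds n = (b', s')"
    "\<And>i. i < n \<Longrightarrow> can_jump pc (fst (jstate pc (after_jump pc (fst p) s d) (sq_add s d 2) ds i))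
      (snd (jstate pc (after_jump pc (fst p) s d) (sq_add s d 2) ds i)) (ds i)"
    unfolding jumps_iff_jstate by blast
  have "can_jump pc (fst (jstate pc (fst p) s (case_nat d ds) i))
       (snd (jstate pc (fst p) s (case_nat d ds) i)) (case_nat d ds i)" if "i < Suc n" for i
  proof (cases i)
    case 0
    then show ?thesis using 1 by simp
  next
    case (Suc j)
    then show ?thesis using 2(2)[of j] that unfolding Suc jstate_shift by simp
  qed
  moreover have "jstate pc (fst p) s (case_nat d ds) (Suc n) = (b', s')"
    using 2(1) unfolding jstate_shift .
  ultimately show ?R using 1 by (metis fst_conv snd_conv zero_less_Suc)
next
  assume ?R
  then obtain s pc ds n where 1: "fst p s = Some pc" "fst pc = snd p" "0 < n"
    "\<And>i. i < n \<Longrightarrow> can_jump pc (fst (jstate pc (fst p) s ds i)) (snd (jstate pc (fst p) s ds i)) (ds i)"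
    "\<forall>d. \<not> can_jump pc (fst (jstate pc (fst p) s ds n)) (snd (jstate pc (fst p) s ds n)) d"
    "q = (fst (jstate pc (fst p) s ds n), other (snd p))" by blast
  obtain m where n: "n = Suc m" using 1(3) gr0_implies_Suc by blast
  define d ds' where "d = ds 0" and "ds' = (\<lambda>i. ds (Suc i))"
  have ds: "ds = case_nat d ds'"
    by (auto simp: d_def ds'_def split: nat.split)
  have "can_jump pc (fst p) s d" using 1(3) 1(4)[of 0] by (simp add: d_def)
  moreover have "jumps pc (after_jump pc (fst p) s d) (sq_add s d 2)
     (fst (jstate pc (fst p) s ds n)) (snd (jstate pc (fst p) s ds n))"
    unfolding jumps_iff_jstate
  proof (intro exI conjI allI impI)
    show "jstate pc (after_jump pc (fst p) s d) (sq_add s d 2) ds' m =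
       (fst (jstate pc (fst p) s ds n), snd (jstate pc (fst p) s ds n))"
      unfolding ds n jstate_shift by simp
    fix i assume "i < m"
    then show "can_jump pc (fst (jstate pc (after_jump pc (fst p) s d) (sq_add s d 2) ds' i))
          (snd (jstate pc (after_jump pc (fst p) s d) (sq_add s d 2) ds' i)) (ds' i)"
      using 1(4)[of "Suc i"] unfolding ds n jstate_shift by simp
  qed
  ultimately show "fin_jump_move p q" using 1 unfolding fin_jump_move_def by blast
qed

text \<open>\<open>\<exists>d. d \<and> vs i = vec c d\<close> decodes a jump vector into its
  direction bit: it holds iff \<open>vs i = vec c True\<close>. By induction the run follows
  \<open>gst\<close>, and there \<open>gstep_gst\<close> takes each test back to the initial
  board.\<close>

lemma jstate_static:
  assumes "g s = Some c"
    "\<And>i. i < n \<Longrightarrow> can_jump (c, Pawn) (fst (jstate (c, Pawn) (brd g) (emb s) vs i))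
        (snd (jstate (c, Pawn) (brd g) (emb s) vs i)) (vs i)"
  shows "\<forall>i<n. vs i = vec c (\<exists>d. d \<and> vs i = vec c d) \<and>
     gstep g c (wpos c (\<lambda>i. \<exists>d. d \<and> vs i = vec c d) s i) (\<exists>d. d \<and> vs i = vec c d)"
  using assms(2)
proof (induction n)
  case (Suc n)
  define ds where "ds = (\<lambda>i. \<exists>d. d \<and> vs i = vec c d)"
  have IH: "\<And>i. i < n \<Longrightarrow> vs i = vec c (ds i)" "\<And>i. i < n \<Longrightarrow> gstep g c (wpos c ds s i) (ds i)"
    using Suc by (auto simp: ds_def)
  have "jstate (c, Pawn) (brd g) (emb s) vs n = jstate (c, Pawn) (brd g) (emb s) (\<lambda>i. vec c (ds i)) n"
    using IH by (intro jstate_cong) auto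
  also have "\<dots> = (brd (gst g c ds s n), emb (wpos c ds s n))"
    using assms(1) IH(2) by (rule jstate_brd)
  finally have "can_jump (c, Pawn) (brd (gst g c ds s n)) (emb (wpos c ds s n)) (vs n)"
    using Suc.prems[of n] by simp
  then obtain d where d: "vs n = vec c d" "gstep g c (wpos c ds s n) d"
    by (auto simp: can_jump_brd gstep_gst)
  have "ds n = d" using d by (auto simp: ds_def vec_inj)
  then have "vs n = vec c (ds n) \<and> gstep g c (wpos c ds s n) (ds n)" using d by simp
  then show ?case using IH unfolding ds_def less_Suc_eq by blast
qed auto

lemma has_jump_brd: "has_jump (brd g, c) \<longleftrightarrow> gcanjump g c"
proof -
  have "has_jump (brd g, c) \<longleftrightarrow> (\<exists>s v. g s = Some c \<and> can_jump (c, Pawn) (brd g) (emb s) v)"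
    unfolding has_jump_def
  proof (intro iffI; elim exE conjE)
    fix t pc v assume *: "fst (brd g, c) t = Some pc" "fst pc = snd (brd g, c)"
      "can_jump pc (fst (brd g, c)) t v"
    obtain s where "t = emb s" "g s = Some c" "pc = (c, Pawn)"
      using *(1,2) by (auto elim: brd_SomeE)
    then show "\<exists>s v. g s = Some c \<and> can_jump (c, Pawn) (brd g) (emb s) v"
      using * by auto
  next
    fix s v assume "g s = Some c" "can_jump (c, Pawn) (brd g) (emb s) v"
    then show "\<exists>s pc v. fst (brd g, c) s = Some pc \<and> fst pc = snd (brd g, c) \<and>
        can_jump pc (fst (brd g, c)) s v"
      by (intro exI[of _ "emb s"] exI[of _ "(c, Pawn)"] exI[of _ v]) (simp add: brd_emb)
  qed
  then show ?thesis by (auto simp: can_jump_brd gcanjump_def)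
qed

lemma simple_move_brd: "simple_move (brd g, c) q \<longleftrightarrow> (\<exists>g'. q = (brd g', other c) \<and> gsimple g c g')"
proof -
  have "simple_move (brd g, c) q \<longleftrightarrow> (\<exists>s d. g s = Some c \<and> brd g (sq_add (emb s) (vec c d) 1) = None \<and>
     q = ((brd g)(emb s := None, sq_add (emb s) (vec c d) 1 := Some (c, Pawn)), other c))"
    (is "_ \<longleftrightarrow> ?R")
  proof
    assume "simple_move (brd g, c) q"
    then obtain t pc v where *: "brd g t = Some pc" "fst pc = c" "v \<in> dirs pc"
      "brd g (sq_add t v 1) = None"
      "q = ((brd g)(t := None, sq_add t v 1 := Some pc), other c)"
      by (auto simp: simple_move_def)
    obtain s where s: "t = emb s" "g s = Some c" "pc = (c, Pawn)"
      using *(1,2) by (auto elim: brd_SomeE)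
    obtain d where "v = vec c d" using *(3) s(3) by (auto simp: dirs_Pawn)
    then show ?R using * s by (intro exI[of _ s] exI[of _ d]) simp
  next
    assume ?R
    then obtain s d where *: "g s = Some c" "brd g (sq_add (emb s) (vec c d) 1) = None"
     "q = ((brd g)(emb s := None, sq_add (emb s) (vec c d) 1 := Some (c, Pawn)), other c)" by blast
    have "brd g (emb s) = Some (c, Pawn)" "vec c d \<in> dirs (c, Pawn)"
      using * by (auto simp: brd_emb dirs_Pawn)
    then show "simple_move (brd g, c) q" unfolding simple_move_def using *
      by (metis fst_conv snd_conv)
  qed
  then show ?thesis
    unfolding emb_mv[symmetric] brd_upd_None brd_upd_Some gsimple_def by (auto simp: brd_emb)
qed

lemma fin_jump_move_brd: "fin_jump_move (brd g, c) q \<longleftrightarrow> (\<exists>g'. q = (brd g', other c) \<and> gfin g c g')"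
proof
  assume "fin_jump_move (brd g, c) q"
  then obtain t pc vs n where 1: "brd g t = Some pc" "fst pc = c" "0 < n"
    "\<And>i. i < n \<Longrightarrow> can_jump pc (fst (jstate pc (brd g) t vs i)) (snd (jstate pc (brd g) t vs i)) (vs i)"
    "\<forall>d. \<not> can_jump pc (fst (jstate pc (brd g) t vs n)) (snd (jstate pc (brd g) t vs n)) d"
    "q = (fst (jstate pc (brd g) t vs n), other c)"
    unfolding fin_jump_move_iff fst_conv snd_conv by blast
  obtain s where s: "t = emb s" "g s = Some c" "pc = (c, Pawn)"
    using 1(1,2) by (auto elim: brd_SomeE)
  define ds where "ds = (\<lambda>i. \<exists>d. d \<and> vs i = vec c d)"
  have st: "\<And>i. i < n \<Longrightarrow> vs i = vec c (ds i)" "\<And>i. i < n \<Longrightarrow> gstep g c (wpos c ds s i) (ds i)"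
    using jstate_static[of g s c n vs] 1(4) s by (auto simp: ds_def)
  have "jstate pc (brd g) t vs n = jstate (c, Pawn) (brd g) (emb s) (\<lambda>i. vec c (ds i)) n"
    using st unfolding s by (intro jstate_cong) auto
  also have "\<dots> = (brd (gst g c ds s n), emb (wpos c ds s n))"
    using s(2) st(2) by (rule jstate_brd)
  finally have "q = (brd (gst g c ds s n), other c)" "\<forall>d. \<not> gstep g c (wpos c ds s n) d"
    using 1(5,6) s by (auto simp: can_jump_brd gstep_gst)
  then show "\<exists>g'. q = (brd g', other c) \<and> gfin g c g'"
    using s(2) 1(3) st(2) unfolding gfin_def by blast
next
  assume "\<exists>g'. q = (brd g', other c) \<and> gfin g c g'"
  then obtain s ds n where *: "g s = Some c" "0 < n" "\<And>i. i < n \<Longrightarrow> gstep g c (wpos c ds s i) (ds i)"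
    "\<forall>d. \<not> gstep g c (wpos c ds s n) d" "q = (brd (gst g c ds s n), other c)"
    unfolding gfin_def by blast
  have "jstate (c, Pawn) (brd g) (emb s) (\<lambda>i. vec c (ds i)) m =
    (brd (gst g c ds s m), emb (wpos c ds s m))" if "m \<le> n" for m
    using * that by (intro jstate_brd) auto
  then show "fin_jump_move (brd g, c) q"
    unfolding fin_jump_move_iff using *
    by (intro exI[of _ "emb s"] exI[of _ "(c, Pawn)"] exI[of _ "\<lambda>i. vec c (ds i)"] exI[of _ n])
      (auto simp: brd_emb can_jump_brd gstep_gst vec_inj)
qed

lemma inf_jump_move_brd: "inf_jump_move (brd g, c) q \<longleftrightarrow> (\<exists>g'. q = (brd g', other c) \<and> ginfm g c g')"
proof
  assume "inf_jump_move (brd g, c) q"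
  then obtain t pc vs where 1: "brd g t = Some pc" "fst pc = c"
    "\<And>i. can_jump pc (fst (jstate pc (brd g) t vs i)) (snd (jstate pc (brd g) t vs i)) (vs i)"
    "q = ((\<lambda>u. if u = t \<or> (\<exists>n. u = sq_add (snd (jstate pc (brd g) t vs n)) (vs n) 1)
               then None else brd g u), other c)"
    unfolding inf_jump_move_def fst_conv snd_conv by blast
  obtain s where s: "t = emb s" "g s = Some c" "pc = (c, Pawn)"
    using 1(1,2) by (auto elim: brd_SomeE)
  define ds where "ds = (\<lambda>i. \<exists>d. d \<and> vs i = vec c d)"
  have st: "vs i = vec c (ds i)" "gstep g c (wpos c ds s i) (ds i)" for i
    using jstate_static[of g s c "Suc i" vs] 1(3) s by (auto simp: ds_def)
  have vs: "vs = (\<lambda>i. vec c (ds i))" using st by auto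
  have "jstate pc (brd g) t vs n = (brd (gst g c ds s n), emb (wpos c ds s n))" for n
    unfolding s vs using s(2) st(2) by (rule jstate_brd)
  then have "q = ((\<lambda>u. if u = emb s \<or> (\<exists>n. u = emb (wmid c ds s n)) then None else brd g u), other c)"
    using 1(4) unfolding vs s by (simp add: emb_mv[symmetric] wmid_def)
  moreover have "(\<lambda>u. if u = emb s \<or> (\<exists>n. u = emb (wmid c ds s n)) then None else brd g u) =
     brd (ginf g c ds s)"
    by (rule brd_eqI) (auto simp: ginf_def emb_inj brd_emb brd_dark split: if_splits)
  ultimately show "\<exists>g'. q = (brd g', other c) \<and> ginfm g c g'"
    unfolding ginfm_def using s(2) st(2) by blast
next
  assume "\<exists>g'. q = (brd g', other c) \<and> ginfm g c g'"
  then obtain s ds where *: "g s = Some c" "\<And>i. gstep g c (wpos c ds s i) (ds i)"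
    "q = (brd (ginf g c ds s), other c)"
    unfolding ginfm_def by blast
  have j: "jstate (c, Pawn) (brd g) (emb s) (\<lambda>i. vec c (ds i)) m =
    (brd (gst g c ds s m), emb (wpos c ds s m))" for m
    using * by (intro jstate_brd) auto
  have "(\<lambda>u. if u = emb s \<or> (\<exists>n. u = emb (wmid c ds s n)) then None else brd g u) =
     brd (ginf g c ds s)"
    by (rule brd_eqI) (auto simp: ginf_def emb_inj brd_emb brd_dark split: if_splits)
  then show "inf_jump_move (brd g, c) q"
    unfolding inf_jump_move_def fst_conv snd_conv using *
    by (intro exI[of _ "emb s"] exI[of _ "(c, Pawn)"] exI[of _ "\<lambda>i. vec c (ds i)"])
      (auto simp: brd_emb can_jump_brd gstep_gst vec_inj j emb_mv[symmetric] wmid_def[symmetric])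
qed

lemma legal_move_brd: "legal_move (brd g, c) q \<longleftrightarrow> (\<exists>g'. q = (brd g', other c) \<and> gmove g c g')"
  unfolding legal_move_def gmove_def has_jump_brd fin_jump_move_brd inf_jump_move_brd simple_move_brd
  by auto

section \<open>The reflection symmetry\<close>

text \<open>On the checkerboard this is the mirror image x to 6 - x, which respects the direction of
  pawns. The odd shift 3 makes it exchange (even, even) and (odd, odd) squares.\<close>

fun tau :: "int \<times> int \<Rightarrow> int \<times> int" where
  "tau (a, b) = (b + 3, a - 3)"

lemma tau_tau: "tau (tau s) = s"
  by (cases s) auto

lemma tau_comp_tau: "h \<circ> tau \<circ> tau = h"
  by (auto simp: tau_tau)

lemma tau_eq_iff: "tau s = t \<longleftrightarrow> s = tau t"
  using tau_tau by metis

lemma tau_mv: "tau (mv c d k s) = mv c (\<not> d) k (tau s)"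
  by (cases s) auto

lemma gstep_tau: "gstep (g \<circ> tau) c s d \<longleftrightarrow> gstep g c (tau s) (\<not> d)"
  by (simp add: gstep_def tau_mv)

lemma tau_wpos: "tau (wpos c ds s n) = wpos c (Not \<circ> ds) (tau s) n"
  by (induction n) (auto simp: tau_mv)

lemma tau_wmid: "tau (wmid c ds s n) = wmid c (Not \<circ> ds) (tau s) n"
  by (auto simp: wmid_def tau_mv tau_wpos)

lemma gst_tau: "gst g c ds s n \<circ> tau = gst (g \<circ> tau) c (Not \<circ> ds) (tau s) n"
  by (auto simp: gst_def fun_eq_iff tau_eq_iff tau_wpos tau_wmid)

lemma ginf_tau: "ginf g c ds s \<circ> tau = ginf (g \<circ> tau) c (Not \<circ> ds) (tau s)"
  by (auto simp: ginf_def fun_eq_iff tau_eq_iff tau_wmid)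

lemma Not_comp_Not: "Not \<circ> (Not \<circ> f) = f"
  by auto

lemma gstep_tau_wpos:
  "gstep (g \<circ> tau) c (wpos c (Not \<circ> ds) (tau s) n) d \<longleftrightarrow> gstep g c (wpos c ds s n) (\<not> d)"
  by (simp add: gstep_tau tau_wpos tau_tau Not_comp_Not)

lemma gcanjump_tau: "gcanjump (g \<circ> tau) c \<longleftrightarrow> gcanjump g c"
proof -
  have "gcanjump (g \<circ> tau) c" if "gcanjump g c" for g
  proof -
    obtain s d where "g s = Some c" "gstep g c s d" using \<open>gcanjump g c\<close> by (auto simp: gcanjump_def)
    then have "(g \<circ> tau) (tau s) = Some c" "gstep (g \<circ> tau) c (tau s) (\<not> d)"
      by (auto simp: gstep_tau tau_tau)
    then show ?thesis unfolding gcanjump_def by blast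
  qed
  from this[of g] this[of "g \<circ> tau"] show ?thesis by (auto simp: tau_comp_tau)
qed

lemma gmove_tauI:
  assumes "gmove g c g'"
  shows "gmove (g \<circ> tau) c (g' \<circ> tau)"
proof -
  have 1: "gfin (g \<circ> tau) c (g' \<circ> tau)" if p: "gfin g c g'"
  proof -
    obtain s ds n where *: "g s = Some c" "0 < n" "\<forall>i<n. gstep g c (wpos c ds s i) (ds i)"
     "\<forall>d. \<not> gstep g c (wpos c ds s n) d" "g' = gst g c ds s n" using p unfolding gfin_def by blast
    then show ?thesis unfolding gfin_def
      by (intro exI[of _ "tau s"] exI[of _ "Not \<circ> ds"] exI[of _ n])
        (auto simp: gstep_tau_wpos gst_tau tau_tau)
  qed
  have 2: "ginfm (g \<circ> tau) c (g' \<circ> tau)" if p: "ginfm g c g'"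
  proof -
    obtain s ds where *: "g s = Some c" "\<forall>i. gstep g c (wpos c ds s i) (ds i)"
     "g' = ginf g c ds s" using p unfolding ginfm_def by blast
    then show ?thesis unfolding ginfm_def
      by (intro exI[of _ "tau s"] exI[of _ "Not \<circ> ds"])
        (auto simp: gstep_tau_wpos ginf_tau tau_tau)
  qed
  have 3: "gsimple (g \<circ> tau) c (g' \<circ> tau)" if p: "gsimple g c g'"
  proof -
    obtain s d where *: "g s = Some c" "g (mv c d 1 s) = None"
      "g' = g(s := None, mv c d 1 s := Some c)" using p unfolding gsimple_def by blast
    then have "g' \<circ> tau = (g \<circ> tau)(tau s := None, mv c (\<not> d) 1 (tau s) := Some c)"
      by (auto simp: fun_eq_iff tau_eq_iff tau_mv)
    then show ?thesis unfolding gsimple_def using *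
      by (intro exI[of _ "tau s"] exI[of _ "\<not> d"]) (auto simp: tau_tau tau_mv[symmetric])
  qed
  show ?thesis using assms 1 2 3 unfolding gmove_def gcanjump_tau by (auto split: if_splits)
qed

text \<open>Asking for the value on a board and on its mirror image makes invariance under
  \<open>tau\<close> immediate. The rules below carry both halves along, which saves a separate
  induction over values.\<close>

definition Val :: "color \<Rightarrow> grid \<Rightarrow> 'o::wellorder \<Rightarrow> bool" where
  "Val c h \<alpha> \<longleftrightarrow> has_value (brd h, c) \<alpha> \<and> has_value (brd (h \<circ> tau), c) \<alpha>"

lemma Val_tau: "Val c (h \<circ> tau) \<alpha> \<longleftrightarrow> Val c h \<alpha>"
  unfolding Val_def tau_comp_tau by auto

lemma gmove_tauD: "gmove (h \<circ> tau) c g' \<Longrightarrow> gmove h c (g' \<circ> tau)"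
  using gmove_tauI[of "h \<circ> tau" c g'] by (simp only: tau_comp_tau)

lemma legal_move_tau: "legal_move (brd (h \<circ> tau), c) q \<longleftrightarrow>
    (\<exists>h'. q = (brd (h' \<circ> tau), other c) \<and> gmove h c h')"
  unfolding legal_move_brd by (metis gmove_tauI gmove_tauD tau_comp_tau)

lemma Val_won:
  assumes "\<And>h'. \<not> gmove h Black h'" "\<And>\<gamma>. \<alpha> \<le> \<gamma>"
  shows "Val Black h \<alpha>"
proof -
  have "won (brd h, Black)" using assms(1) by (simp add: won_def legal_move_brd)
  moreover have "won (brd (h \<circ> tau), Black)" using assms(1) by (simp add: won_def legal_move_tau)
  ultimately show ?thesis unfolding Val_def by (intro conjI has_value_won assms)
qed

text \<open>The last hypothesis provides minimality of \<beta> in two ways: Red's move is forced, or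
  \<beta> is zero. In the second case the other moves of Red need not be examined.\<close>

lemma Val_succ:
  assumes "gmove h Red h'" "Val Black h' \<beta>" "is_succ \<beta> \<alpha>"
    "(\<forall>h''. gmove h Red h'' \<longrightarrow> h'' = h') \<or> (\<forall>\<gamma>. \<beta> \<le> \<gamma>)"
  shows "Val Red h \<alpha>"
  unfolding Val_def
proof (intro conjI)
  show "has_value (brd h, Red) \<alpha>"
  proof (rule has_value_succI)
    show "legal_move (brd h, Red) (brd h', Black)" using assms(1) by (auto simp: legal_move_brd)
    fix \<gamma> :: 'a and q' assume q': "legal_move (brd h, Red) q'" "\<gamma> < \<beta>"
    show "\<not> has_value q' \<gamma>"
      using assms(4)
    proof
      assume "\<forall>h''. gmove h Red h'' \<longrightarrow> h'' = h'"
      then have "q' = (brd h', Black)" using q' by (auto simp: legal_move_brd)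
      then show ?thesis using assms(2) q'(2) has_value_unique unfolding Val_def by blast
    qed (use q'(2) in \<open>auto simp: not_less[symmetric]\<close>)
  qed (use assms in \<open>auto simp: Val_def\<close>)
  show "has_value (brd (h \<circ> tau), Red) \<alpha>"
  proof (rule has_value_succI)
    show "legal_move (brd (h \<circ> tau), Red) (brd (h' \<circ> tau), Black)"
      using assms(1) by (auto simp: legal_move_tau)
    fix \<gamma> :: 'a and q' assume q': "legal_move (brd (h \<circ> tau), Red) q'" "\<gamma> < \<beta>"
    show "\<not> has_value q' \<gamma>"
      using assms(4)
    proof
      assume "\<forall>h''. gmove h Red h'' \<longrightarrow> h'' = h'"
      then have "q' = (brd (h' \<circ> tau), Black)" using q' by (auto simp: legal_move_tau)
      then show ?thesis using assms(2) q'(2) has_value_unique unfolding Val_def by blast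
    qed (use q'(2) in \<open>auto simp: not_less[symmetric]\<close>)
  qed (use assms in \<open>auto simp: Val_def\<close>)
qed

lemma Val_Sup:
  assumes "gmove h Black h0"
    and "\<And>h'. gmove h Black h' \<Longrightarrow> \<exists>\<gamma>\<le>\<alpha>. Val Red h' \<gamma>"
    and "\<And>\<delta>. \<delta> < \<alpha> \<Longrightarrow> \<exists>h' \<gamma>. gmove h Black h' \<and> \<delta> < \<gamma> \<and> Val Red h' \<gamma>"
  shows "Val Black h \<alpha>"
  unfolding Val_def
proof (intro conjI)
  show "has_value (brd h, Black) \<alpha>"
  proof (rule has_value_SupI)
    show "legal_move (brd h, Black) (brd h0, Red)" using assms(1) by (auto simp: legal_move_brd)
  next
    fix q assume "legal_move (brd h, Black) q"
    then obtain h' where "q = (brd h', Red)" "gmove h Black h'" by (auto simp: legal_move_brd)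
    then show "\<exists>\<gamma>\<le>\<alpha>. has_value q \<gamma>" using assms(2)[of h'] by (auto simp: Val_def)
  next
    fix \<delta> assume "\<delta> < \<alpha>"
    then show "\<exists>q \<gamma>. legal_move (brd h, Black) q \<and> \<delta> < \<gamma> \<and> has_value q \<gamma>"
      using assms(3)[of \<delta>] by (auto simp: Val_def legal_move_brd)
  qed auto
  show "has_value (brd (h \<circ> tau), Black) \<alpha>"
  proof (rule has_value_SupI)
    show "legal_move (brd (h \<circ> tau), Black) (brd (h0 \<circ> tau), Red)"
      using assms(1) by (auto simp: legal_move_tau)
  next
    fix q assume "legal_move (brd (h \<circ> tau), Black) q"
    then obtain h' where "q = (brd (h' \<circ> tau), Red)" "gmove h Black h'" by (auto simp: legal_move_tau)
    then show "\<exists>\<gamma>\<le>\<alpha>. has_value q \<gamma>" using assms(2)[of h'] by (auto simp: Val_def)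
  next
    fix \<delta> assume "\<delta> < \<alpha>"
    then show "\<exists>q \<gamma>. legal_move (brd (h \<circ> tau), Black) q \<and> \<delta> < \<gamma> \<and> has_value q \<gamma>"
      using assms(3)[of \<delta>] by (auto simp: Val_def legal_move_tau)
  qed auto
qed

section \<open>The board of a tree\<close>

text \<open>The gadget of a node in its orientation: the black pawn on \<open>(9, 9)\<close> is the runner of the ray,
  the black pawn on \<open>(4, 11)\<close> releases it by jumping along row 11 over \<open>(9, 11)\<close>, and this pawn in turn
  is released by the parent's runner, who leaves the parent's ray (row 6) along column 6. The pieces
  on \<open>(6, 15)\<close> and \<open>(13, 11)\<close> capture the two stuck pawns; the other red pieces immobilise and
  protect the black pawns.\<close>

definition pat :: "int \<Rightarrow> int \<Rightarrow> color option" where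
  "pat u v =
    (if (u, v) \<in> {(4, 11), (9, 9)} then Some Black
     else if (u = 9 \<and> 8 \<le> v \<and> even v) \<or>
       (u, v) \<in> {(6, 7), (6, 9), (6, 11), (6, 13), (6, 15), (6, 16),
         (3, 11), (5, 11), (7, 11), (9, 11), (11, 11), (13, 11), (14, 11),
         (4, 10), (4, 12), (4, 13), (8, 9), (10, 9), (11, 9)} then Some Red
     else None)"

text \<open>Symmetric in its arguments, so that the union of the two orientations is compatible with
  \<open>tau\<close>. Crossing rays overlap in a red piece of each.\<close>

definition join :: "color option \<Rightarrow> color option \<Rightarrow> color option" where
  "join x y = (if x = Some Black \<or> y = Some Black then Some Black
     else if x = Some Red \<or> y = Some Red then Some Red else None)"

text \<open>If the four squares ahead are occupied, a black pawn on \<open>s\<close> can neither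
  step nor jump; if the two squares behind it are occupied, Red has no landing square for capturing
  it.\<close>

definition guards :: "int \<times> int \<Rightarrow> (int \<times> int) set" where
  "guards s = (case s of (a, b) \<Rightarrow> {(a + 1, b), (a + 2, b), (a, b + 1), (a, b + 2), (a - 1, b), (a, b - 1)})"

definition guarded :: "grid \<Rightarrow> int \<times> int \<Rightarrow> bool" where
  "guarded h s \<longleftrightarrow> (\<forall>t\<in>guards s. h t \<noteq> None)"

lemma guarded_tau: "guarded (h \<circ> tau) s \<longleftrightarrow> guarded h (tau s)"
  by (cases s) (auto simp: guarded_def guards_def algebra_simps)

lemma join_None: "join x y = None \<longleftrightarrow> x = None \<and> y = None"
  by (cases x; cases y) (auto simp: join_def intro: color.exhaust)

lemma join_Black: "join x y = Some Black \<longleftrightarrow> x = Some Black \<or> y = Some Black"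
  by (auto simp: join_def)

lemma join_None2: "join x None = x"
  by (cases x) (auto simp: join_def intro: color.exhaust)

text \<open>The inequality puts the gadget of a child \<open>d\<close> of \<open>c\<close> far along
  the ray of \<open>c\<close>: this ray starts in the band of \<open>par c\<close>, and
  \<open>par c + 2 \<le> d\<close>.\<close>

locale tree_board =
  fixes node :: "int \<Rightarrow> bool" and par :: "int \<Rightarrow> int"
  assumes par_nonneg: "node n \<Longrightarrow> 0 \<le> par n" and par_less: "node n \<Longrightarrow> par n < n"
begin

text \<open>The gadgets of the vertical nodes, those with \<open>hv n\<close>. A node owns 20
  columns, and its rows are counted from the band in which the ray of its parent runs.\<close>

definition cell :: "(int \<Rightarrow> bool) \<Rightarrow> int \<times> int \<Rightarrow> color option" where
  "cell hv s = (let n = fst s div 20 in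
     if node n \<and> hv n then pat (fst s mod 20) (snd s - 20 * par n) else None)"

text \<open>The piece on \<open>(-7, -10)\<close>, a fixed point of \<open>tau\<close>, provides a harmless move for Red.\<close>

definition base :: "(int \<Rightarrow> bool) \<Rightarrow> grid" where
  "base hv s = (if s = (-7, -10) then Some Red else join (cell hv s) (cell (Not \<circ> hv) (tau s)))"

text \<open>Mirroring exchanges the two orientations, so it is enough to study horizontal runners
  and the relay pawns of vertical nodes.\<close>

lemma base_tau: "base (Not \<circ> hv) \<circ> tau = base hv"
  by (auto simp: base_def fun_eq_iff tau_eq_iff tau_tau Not_comp_Not join_def)

lemma cell_eval: "0 \<le> u \<Longrightarrow> u < 20 \<Longrightarrow>
    cell hv (20 * n + u, b) = (if node n \<and> hv n then pat u (b - 20 * par n) else None)"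
  by (simp add: cell_def)

lemma cell_tau_eval: "-3 \<le> v \<Longrightarrow> v < 17 \<Longrightarrow>
    cell hv (tau (a, 20 * n + v)) = (if node n \<and> hv n then pat (v + 3) (a - 3 - 20 * par n) else None)"
  using cell_eval[of "v + 3" hv n "a - 3"] by (simp add: add.assoc)

text \<open>The only horizontal gadget in these rows is that of \<open>par d\<close>. From row 7 on,
  it is seen in columns of \<open>pat\<close> from 10 on, beyond its ray in column 9, and at
  distance at least 37, where \<open>pat\<close> has nothing but the ray.\<close>

lemma base_gadget:
  assumes "node d" "hv d" "0 \<le> u" "u < 20" "7 \<le> v" "v < 17"
  shows "base hv (20 * d + u, 20 * par d + v) = pat u v"
proof -
  have "pat (v + 3) (20 * d + u - 3 - 20 * par (par d)) = None" if "node (par d)"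
    using par_less[OF assms(1)] par_less[OF that] assms by (auto simp: pat_def)
  then have "cell (Not \<circ> hv) (tau (20 * d + u, 20 * par d + v)) = None"
    using cell_tau_eval[of v "Not \<circ> hv" "20 * d + u" "par d"] assms by auto
  moreover have "20 * par d + v \<noteq> -10" using par_nonneg[OF assms(1)] assms by linarith
  ultimately show ?thesis using assms unfolding base_def
    by (simp add: cell_eval join_None2 del: tau.simps)
qed

lemma pat_row:
  assumes "v = 20 * k + 6"
  shows "pat u v = (if u = 9 \<and> 1 \<le> k then Some Red else None)"
proof -
  have "v \<noteq> 7" "v \<noteq> 9" "v \<noteq> 10" "v \<noteq> 11" "v \<noteq> 12" "v \<noteq> 13" "v \<noteq> 15" "v \<noteq> 16"
    using assms by presburger+
  moreover have "8 \<le> v \<longleftrightarrow> 1 \<le> k" "even v" using assms by presburger+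
  ultimately show ?thesis by (simp add: pat_def)
qed

text \<open>Vertical gadgets meet a row congruent to 6 modulo 20 only with their rays, in columns
  congruent to 9, where the horizontal ray has a red piece as well. The bound 15 = 12 + 3 skips the
  start of the ray, which contains the runner and its blocker.\<close>

lemma base_row:
  assumes "node c" "\<not> hv c" "20 * par c + 15 \<le> a"
  shows "base hv (a, 20 * c + 6) = (if odd a then Some Red else None)"
proof -
  have 1: "cell hv (a, 20 * c + 6) = None \<or> odd a \<and> cell hv (a, 20 * c + 6) = Some Red"
  proof -
    have "pat (a mod 20) (20 * c + 6 - 20 * par (a div 20)) =
        (if a mod 20 = 9 \<and> 1 \<le> c - par (a div 20) then Some Red else None)"
      by (rule pat_row) simp
    moreover have "a mod 20 = 9 \<Longrightarrow> odd a" by presburger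
    ultimately show ?thesis by (auto simp: cell_def Let_def split: if_splits)
  qed
  have "cell (Not \<circ> hv) (tau (a, 20 * c + 6)) = pat 9 (a - 3 - 20 * par c)"
    using assms cell_tau_eval[of 6 "Not \<circ> hv" a c] by simp
  also have "\<dots> = (if odd a then Some Red else None)"
    using assms(3) by (auto simp: pat_def)
  finally have 2: "cell (Not \<circ> hv) (tau (a, 20 * c + 6)) = (if odd a then Some Red else None)" .
  have "0 \<le> a" using assms par_nonneg[of c] by simp
  then show ?thesis using 1 2 unfolding base_def by (auto simp: join_def)
qed

lemma pat_above:
  assumes "even u" "v = 20 * k + 7"
  shows "pat u v = (if u = 6 \<and> k = 0 then Some Red else None)"
proof -
  have "v \<noteq> 9" "v \<noteq> 10" "v \<noteq> 11" "v \<noteq> 12" "v \<noteq> 13" "v \<noteq> 15" "v \<noteq> 16"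
    using assms by presburger+
  moreover have "v = 7 \<longleftrightarrow> k = 0" "u \<noteq> 9" using assms by presburger+
  ultimately show ?thesis by (simp add: pat_def)
qed

text \<open>This ties the turns of a runner to the tree: a runner stands on even columns, and the
  piece (6, 7) of a child's gadget is the only kind that it could jump upwards.\<close>

lemma base_above_row:
  assumes "node c" "\<not> hv c" "20 * par c + 15 \<le> a" "even a" "base hv (a, 20 * c + 7) = Some Red"
  obtains d where "node d" "hv d" "par d = c" "a = 20 * d + 6"
proof -
  have "cell (Not \<circ> hv) (tau (a, 20 * c + 7)) = pat 10 (a - 3 - 20 * par c)"
    using assms cell_tau_eval[of 7 "Not \<circ> hv" a c] by simp
  also have "\<dots> = None"
    using assms(3) by (auto simp: pat_def)
  finally have 2: "cell (Not \<circ> hv) (tau (a, 20 * c + 7)) = None" .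
  have "0 \<le> a" using assms par_nonneg[of c] by simp
  then have "cell hv (a, 20 * c + 7) = Some Red"
    using assms(5) 2 by (auto simp: base_def join_None2)
  then have *: "node (a div 20)" "hv (a div 20)"
      "pat (a mod 20) (20 * c + 7 - 20 * par (a div 20)) = Some Red"
    by (auto simp: cell_def Let_def split: if_splits)
  have "even (a mod 20)" using assms(4) by presburger
  then have "pat (a mod 20) (20 * c + 7 - 20 * par (a div 20)) =
      (if a mod 20 = 6 \<and> c - par (a div 20) = 0 then Some Red else None)"
    by (rule pat_above) simp
  then have "a mod 20 = 6 \<and> c = par (a div 20)" using *(3) by (auto split: if_splits)
  moreover have "a mod 20 = 6 \<Longrightarrow> a = 20 * (a div 20) + 6" by presburger
  ultimately show thesis using *(1,2) by (intro that[of "a div 20"]) auto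
qed

text \<open>In this order: relay pawns and runners of vertical nodes, then relay pawns and runners
  of horizontal nodes.\<close>

lemma base_Black_cases:
  assumes "base hv s = Some Black"
  obtains n where "node n" "hv n" "s = (20 * n + 4, 20 * par n + 11)"
  | n where "node n" "hv n" "s = (20 * n + 9, 20 * par n + 9)"
  | n where "node n" "\<not> hv n" "s = (20 * par n + 14, 20 * n + 1)"
  | n where "node n" "\<not> hv n" "s = (20 * par n + 12, 20 * n + 6)"
proof -
  have pat: "pat u v = Some Black \<longleftrightarrow> u = 4 \<and> v = 11 \<or> u = 9 \<and> v = 9" for u v
    by (auto simp: pat_def)
  have cell: "\<exists>n. node n \<and> hv n \<and> (s = (20 * n + 4, 20 * par n + 11) \<or> s = (20 * n + 9, 20 * par n + 9))"
    if "cell hv s = Some Black" for hv s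
  proof -
    from that have *: "node (fst s div 20)" "hv (fst s div 20)"
      "pat (fst s mod 20) (snd s - 20 * par (fst s div 20)) = Some Black"
      by (auto simp: cell_def Let_def split: if_splits)
    have "fst s mod 20 = r \<Longrightarrow> fst s = 20 * (fst s div 20) + r" for r by presburger
    from this[of 4] this[of 9] show ?thesis using *(3) unfolding pat
      by (intro exI[of _ "fst s div 20"] conjI *) (simp add: prod_eq_iff, linarith)
  qed
  have "cell hv s = Some Black \<or> cell (Not \<circ> hv) (tau s) = Some Black"
    using assms by (auto simp: base_def join_Black split: if_splits)
  then show thesis
  proof
    assume "cell hv s = Some Black"
    from cell[OF this] show thesis using that(1,2) by auto
  next
    assume "cell (Not \<circ> hv) (tau s) = Some Black"
    from cell[OF this] show thesis using that(3,4) by (auto simp: tau_eq_iff)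
  qed
qed

lemma base_guarded:
  assumes "base hv s = Some Black"
  shows "guarded (base hv) s"
proof -
  have 1: "base hv t \<noteq> None" if "cell hv t \<noteq> None" for hv t
    using that join_None by (metis base_def option.distinct(1))
  have 2: "base hv (20 * n + u, 20 * par n + v) \<noteq> None"
    if "node n" "hv n" "0 \<le> u" "u < 20" "pat u v \<noteq> None" for hv n u v
    using that by (intro 1) (simp add: cell_eval)
  \<comment> \<open>The instances below are the six guards of (4, 11) and the six guards of (9, 9)
    in \<open>pat\<close>.\<close>
  have V: "guarded (base hv) (20 * n + 4, 20 * par n + 11)"
     "guarded (base hv) (20 * n + 9, 20 * par n + 9)" if n: "node n" "hv n" for hv n
    using 2[of n hv 3 11] 2[of n hv 5 11] 2[of n hv 6 11]
      2[of n hv 4 10] 2[of n hv 4 12] 2[of n hv 4 13]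
      2[of n hv 8 9] 2[of n hv 10 9] 2[of n hv 11 9]
      2[of n hv 9 8] 2[of n hv 9 10] 2[of n hv 9 11] n
    by (simp_all add: guarded_def guards_def pat_def algebra_simps)
  have H: "guarded (base hv) (20 * par n + 14, 20 * n + 1)"
     "guarded (base hv) (20 * par n + 12, 20 * n + 6)" if n: "node n" "\<not> hv n" for n
    using V[of n "Not \<circ> hv"] n base_tau[of hv]
      guarded_tau[of "base (Not \<circ> hv)" "(20 * par n + 14, 20 * n + 1)"]
      guarded_tau[of "base (Not \<circ> hv)" "(20 * par n + 12, 20 * n + 6)"]
    by (simp_all add: add.commute)
  show ?thesis using assms by (cases rule: base_Black_cases) (use V H in auto)
qed

text \<open>Fed to the simplifier, this refutes most memberships in \<open>guards s\<close> by
  comparing residues modulo 20.\<close>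

lemma guards_mod: "t \<in> guards s \<Longrightarrow>
    (fst t mod 20, snd t mod 20) \<in> (\<lambda>t. (fst t mod 20, snd t mod 20)) ` guards s"
  by (rule imageI)

text \<open>A runner empties odd columns of its ray. No pawn other than the runner itself has a
  guard there, so the run leaves the others immobile.\<close>

lemma guards_row:
  assumes "base hv s = Some Black" "(a, 20 * c + 6) \<in> guards s" "odd a"
  shows "s = (20 * par c + 12, 20 * c + 6)"
  using assms(1)
proof (cases rule: base_Black_cases)
  case (4 n)
  have "n = c" using assms(2,3) 4 by (auto simp: guards_def; presburger)
  then show ?thesis using 4 by simp
qed (use guards_mod[OF assms(2)] in \<open>simp add: guards_def\<close>)+

text \<open>Hence changes in the exit column of \<open>d\<close> can set free only the relay pawn of
  \<open>d\<close>.\<close>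

lemma guards_exit:
  assumes "base hv s = Some Black" "(20 * d + 6, b) \<in> guards s"
  shows "s = (20 * d + 4, b)"
  using assms(1)
proof (cases rule: base_Black_cases)
  case (1 n)
  then show ?thesis using assms(2) by (auto simp: guards_def; presburger)
qed (use guards_mod[OF assms(2)] in \<open>simp add: guards_def\<close>)+

text \<open>When a runner leaves its initial square, no other pawn loses a guard.\<close>

lemma guards_start:
  assumes "base hv s = Some Black" "(20 * p + 12, 20 * c + 6) \<in> guards s"
  shows False
  using assms(1)
  by (cases rule: base_Black_cases) (use guards_mod[OF assms(2)] in \<open>simp add: guards_def\<close>)+

text \<open>The run of a relay pawn can affect only that pawn and the runner of the same
  node.\<close>

lemma guards_inner:
  assumes "base hv s = Some Black" "(20 * d + j, 20 * p + 11) \<in> guards s"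
    "j \<in> {4, 5, 7, 9, 11, 12, 13}"
  shows "s \<in> {(20 * d + 4, 20 * p + 11), (20 * d + 9, 20 * p + 9)}"
  using assms(1)
proof (cases rule: base_Black_cases)
  case (1 n)
  then show ?thesis using assms(2,3) by (auto simp: guards_def; presburger)
next
  case (2 n)
  then show ?thesis using assms(2,3) by (auto simp: guards_def; presburger)
qed (use guards_mod[OF assms(2)] assms(3) in \<open>auto simp: guards_def\<close>)+

text \<open>It follows that the spare red piece on (-7, -10) guards nobody and may move
  away.\<close>

lemma guards_nonneg:
  assumes "base hv s = Some Black" "(a, b) \<in> guards s"
  shows "0 \<le> a"
  using assms(1)
proof (cases rule: base_Black_cases)
  case (1 n)
  then show ?thesis using assms(2) par_nonneg[of n] par_less[of n] by (auto simp: guards_def)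
next
  case (2 n)
  then show ?thesis using assms(2) par_nonneg[of n] par_less[of n] by (auto simp: guards_def)
next
  case (3 n)
  then show ?thesis using assms(2) par_nonneg[of n] by (auto simp: guards_def)
next
  case (4 n)
  then show ?thesis using assms(2) par_nonneg[of n] by (auto simp: guards_def)
qed

end

section \<open>Plays on the board of a tree\<close>

lemma mv_mv: "mv c d k (mv c d l s) = mv c d (l + k) s"
  by (cases s) (auto simp: algebra_simps)

lemma mv_0: "mv c d 0 s = s"
  by (cases s) auto

lemma guarded_no_gstep: "guarded h s \<Longrightarrow> \<not> gstep h Black s d"
  by (cases s; cases d) (auto simp: guarded_def guards_def gstep_def)

lemma guarded_blocked: "guarded h s \<Longrightarrow> h (mv Black d 1 s) \<noteq> None"
  by (cases s; cases d) (auto simp: guarded_def guards_def)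

lemma guarded_safe: "guarded h s \<Longrightarrow> h (mv Red d 1 s) \<noteq> None"
  by (cases s; cases d) (auto simp: guarded_def guards_def)

lemma guarded_no_gmove:
  assumes "\<And>s. h s = Some Black \<Longrightarrow> guarded h s"
  shows "\<not> gmove h Black h'"
  using assms guarded_no_gstep guarded_blocked
  by (auto simp: gmove_def gcanjump_def gsimple_def)

lemma red_no_jump:
  assumes "\<And>q e. h q = Some Black \<Longrightarrow> h (mv Red e 1 q) \<noteq> None"
  shows "\<not> gcanjump h Red"
proof
  assume "gcanjump h Red"
  then obtain s e where "h (mv Red e 1 s) = Some Black" "h (mv Red e 2 s) = None"
    by (auto simp: gcanjump_def gstep_def)
  then show False using assms[of "mv Red e 1 s" e] by (simp add: mv_mv)
qed

text \<open>All black pawns other than the stuck one on \<open>T\<close> are safe, and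
  \<open>T\<close> can be captured from one side only, so Red's move is determined.\<close>

lemma red_reply:
  assumes "h T = Some Black" "h (mv Red d (-1) T) = Some Red" "h (mv Red d 1 T) = None"
    and "h (mv Red (\<not> d) (-1) T) = Some Red \<Longrightarrow> h (mv Red (\<not> d) 1 T) \<noteq> None"
    and safe: "\<And>q e. h q = Some Black \<Longrightarrow> q \<noteq> T \<Longrightarrow> h (mv Red e 1 q) \<noteq> None"
  shows "gmove h Red h' \<longleftrightarrow> h' = (\<lambda>x. if x = mv Red d 1 T then Some Red
     else if x = mv Red d (-1) T \<or> x = T then None else h x)"
proof -
  let ?U = "mv Red d (-1) T"
  let ?L = "mv Red d 1 T"
  have step: "mv Red e 1 s = T" if "gstep h Red s e" for s e
    using that safe[of "mv Red e 1 s" e] by (auto simp: gstep_def mv_mv)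
  have U: "gstep h Red ?U d" using assms by (auto simp: gstep_def mv_mv mv_0)
  have uniq: "s = ?U \<and> e = d" if "gstep h Red s e" "h s = Some Red" for s e
  proof -
    have T: "T = mv Red e 1 s" using step[OF that(1)] by simp
    then have s: "s = mv Red e (-1) T" by (simp add: mv_mv mv_0)
    have "h (mv Red e 1 T) = None" using that(1) T by (simp add: gstep_def mv_mv)
    then have "e = d" using that(2) assms(4) unfolding s by (cases e; cases d) auto
    then show ?thesis using s by simp
  qed
  \<comment> \<open>A second jump would have to capture on \<open>T\<close> again, which Red has
    already passed.\<close>
  have L: "\<not> gstep h Red ?L e" for e
  proof
    assume "gstep h Red ?L e"
    from step[OF this] have "pot Red (mv Red e 1 ?L) = pot Red T" by simp
    then show False by (simp add: pot_mv)
  qed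
  have wL: "wpos Red ds ?U (Suc 0) = ?L" if "ds 0 = d" for ds
    using that by (simp add: mv_mv)
  have can: "gcanjump h Red" using U assms(2) by (auto simp: gcanjump_def)
  have inf: "\<not> ginfm h Red h'"
  proof
    assume "ginfm h Red h'"
    then obtain s ds where *: "h s = Some Red" "\<And>i. gstep h Red (wpos Red ds s i) (ds i)"
      unfolding ginfm_def by blast
    have "s = ?U" "ds 0 = d" using uniq[of s "ds 0"] *(1) *(2)[of 0] by auto
    then show False using *(2)[of "Suc 0"] wL L by metis
  qed
  have gst: "gst h Red ds ?U (Suc 0) = (\<lambda>x. if x = ?L then Some Red
     else if x = ?U \<or> x = T then None else h x)" if "ds 0 = d" for ds
    unfolding gst_def wL[of ds, OF that] using that by (auto simp: wmid_def mv_mv mv_0)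
  have "gfin h Red h' \<longleftrightarrow> h' = gst h Red (\<lambda>_. d) ?U (Suc 0)"
  proof
    assume "gfin h Red h'"
    then obtain s ds n where *: "h s = Some Red" "0 < n"
      "\<And>i. i < n \<Longrightarrow> gstep h Red (wpos Red ds s i) (ds i)" "h' = gst h Red ds s n"
      unfolding gfin_def by blast
    have s: "s = ?U" "ds 0 = d" using uniq[of s "ds 0"] *(1) *(3)[of 0] *(2) by auto
    have "n = Suc 0"
    proof (rule ccontr)
      assume "n \<noteq> Suc 0"
      then have "Suc 0 < n" using *(2) by simp
      then show False using *(3)[of "Suc 0"] wL L s by metis
    qed
    then show "h' = gst h Red (\<lambda>_. d) ?U (Suc 0)" using *(4) s gst[of ds] gst[of "\<lambda>_. d"] by simp
  next
    assume "h' = gst h Red (\<lambda>_. d) ?U (Suc 0)"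
    moreover have "\<forall>e. \<not> gstep h Red (wpos Red (\<lambda>_. d) ?U (Suc 0)) e" using L wL by metis
    ultimately show "gfin h Red h'" using assms(2) U unfolding gfin_def
      by (intro exI[of _ ?U] exI[of _ "\<lambda>_. d"] exI[of _ "Suc 0"]) auto
  qed
  then show ?thesis using can inf gst[of "\<lambda>_. d"] unfolding gmove_def by simp
qed

lemma wpos_cong: "(\<And>i. i < n \<Longrightarrow> ds i = ds' i) \<Longrightarrow> wpos c ds s n = wpos c ds' s n"
  by (induction n) auto

lemma gst_cong:
  assumes "\<And>i. i < n \<Longrightarrow> ds i = ds' i"
  shows "gst h c ds s n = gst h c ds' s n"
proof -
  have "wpos c ds s i = wpos c ds' s i" if "i \<le> n" for i
    using assms that by (intro wpos_cong) auto
  then show ?thesis using assms by (auto simp: gst_def wmid_def fun_eq_iff)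
qed

lemma wpos_straight: "(\<And>j. j < i \<Longrightarrow> \<not> ds j) \<Longrightarrow> wpos Black ds (a, b) i = (a + 2 * int i, b)"
  by (induction i) auto

lemma wpos_turn: "wpos Black (\<lambda>i. N \<le> i) (a, b) i =
    (if i \<le> N then (a + 2 * int i, b) else (a + 2 * int N, b + 2 * int (i - N)))"
proof (induction i)
  case (Suc i)
  then show ?case by (auto simp: not_le Suc_diff_le)
qed auto

context tree_board
begin

text \<open>\<open>X\<close> contains the pawn whose turn it is to run. As stuck pawns are captured
  at once, all black pawns stand on original squares whenever Black is to move.\<close>

definition Safe :: "(int \<Rightarrow> bool) \<Rightarrow> grid \<Rightarrow> (int \<times> int) set \<Rightarrow> bool" where
  "Safe hv h X \<longleftrightarrow> (\<forall>s. h s = Some Black \<longrightarrow> base hv s = Some Black \<and> (s \<in> X \<or> guarded h s))"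

text \<open>Red's tempo move, needed after an infinite run.\<close>

definition lone :: "grid \<Rightarrow> bool" where
  "lone h \<longleftrightarrow> h (-7, -10) = Some Red \<and> h (-8, -10) = None \<and> h (-7, -11) = None"

text \<open>\<open>GoodR hv c h\<close>: Black is to move and the runner of the ray of the horizontal node \<open>c\<close> is
  released. \<open>GoodI hv d h\<close>: the releasing pawn of the vertical node \<open>d\<close> may run.\<close>

definition GoodR :: "(int \<Rightarrow> bool) \<Rightarrow> int \<Rightarrow> grid \<Rightarrow> bool" where
  "GoodR hv c h \<longleftrightarrow> (let p = par c in
     h (20 * p + 12, 20 * c + 6) = Some Black \<and> h (20 * p + 13, 20 * c + 6) = Some Red \<and>
     h (20 * p + 14, 20 * c + 6) = None \<and> h (20 * p + 12, 20 * c + 8) \<noteq> None \<and>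
     h (20 * p + 14, 20 * c + 7) \<noteq> Some Red \<and>
     (\<forall>a b. 20 * p + 15 \<le> a \<longrightarrow> 20 * c + 6 \<le> b \<longrightarrow> h (a, b) = base hv (a, b)) \<and>
     Safe hv h {(20 * p + 12, 20 * c + 6)} \<and> lone h)"

definition GoodI :: "(int \<Rightarrow> bool) \<Rightarrow> int \<Rightarrow> grid \<Rightarrow> bool" where
  "GoodI hv d h \<longleftrightarrow> (let p = par d in
     h (20 * d + 6, 20 * p + 11) = None \<and> h (20 * d + 6, 20 * p + 12) \<noteq> Some Red \<and>
     (\<forall>a b. 20 * d + 3 \<le> a \<longrightarrow> 20 * p + 7 \<le> b \<longrightarrow> a \<noteq> 20 * d + 6 \<longrightarrow> h (a, b) = base hv (a, b)) \<and>
     Safe hv h {(20 * d + 4, 20 * p + 11)} \<and> lone h)"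

definition hinf :: "int \<Rightarrow> grid \<Rightarrow> grid" where
  "hinf c h = ginf h Black (\<lambda>_. False) (20 * par c + 12, 20 * c + 6)"

text \<open>\<open>N\<close> counts the jumps along the row from column
  \<open>20 * par c + 12\<close> to column \<open>20 * d + 6\<close>; four jumps upwards
  follow.\<close>

definition hexit :: "int \<Rightarrow> int \<Rightarrow> grid \<Rightarrow> grid" where
  "hexit c d h = (let N = nat (10 * (d - par c) - 3) in
     gst h Black (\<lambda>i. N \<le> i) (20 * par c + 12, 20 * c + 6) (N + 4))"

section \<open>The runs of a released runner\<close>

lemma par_pos: "node c \<Longrightarrow> 0 < c"
  using par_nonneg par_less by (meson le_less_trans)

text \<open>The first two squares of the run lie where the board has been changed, and the explicit
  clauses of \<open>GoodR\<close> exclude a turn there. All later squares lie in the region that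
  still agrees with \<open>base\<close>.\<close>

lemma GoodR_steps:
  assumes G: "GoodR hv c h" and c: "node c" "\<not> hv c" and p: "p = par c"
  shows "gstep h Black (20 * p + 12 + 2 * int n, 20 * c + 6) False"
    and "gstep h Black (20 * p + 12 + 2 * int n, 20 * c + 6) True \<Longrightarrow>
      \<exists>d. node d \<and> hv d \<and> par d = c \<and> n = nat (10 * (d - p) - 3)"
    and "node d \<Longrightarrow> hv d \<Longrightarrow> par d = c \<Longrightarrow> 0 \<le> k \<Longrightarrow> k < 4 \<Longrightarrow>
      gstep h Black (20 * d + 6, 20 * c + 6 + 2 * k) True"
    and "node d \<Longrightarrow> hv d \<Longrightarrow> par d = c \<Longrightarrow> 0 < k \<Longrightarrow> k \<le> 4 \<Longrightarrow>
      \<not> gstep h Black (20 * d + 6, 20 * c + 6 + 2 * k) False"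
    and "node d \<Longrightarrow> hv d \<Longrightarrow> par d = c \<Longrightarrow>
      \<not> gstep h Black (20 * d + 6, 20 * c + 14) True"
proof -
  have G': "h (20 * p + 12, 20 * c + 6) = Some Black" "h (20 * p + 13, 20 * c + 6) = Some Red"
     "h (20 * p + 14, 20 * c + 6) = None" "h (20 * p + 12, 20 * c + 8) \<noteq> None"
     "h (20 * p + 14, 20 * c + 7) \<noteq> Some Red"
     "\<And>a b. 20 * p + 15 \<le> a \<Longrightarrow> 20 * c + 6 \<le> b \<Longrightarrow> h (a, b) = base hv (a, b)"
    using G unfolding GoodR_def Let_def p by auto
  note row = base_row[of c hv, OF c, folded p]
  show "gstep h Black (20 * p + 12 + 2 * int n, 20 * c + 6) False"
  proof (cases n)
    case 0
    then show ?thesis using G'(2,3) by (simp add: gstep_def add.commute)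
  next
    case (Suc m)
    then show ?thesis using row[of "20 * p + 12 + 2 * int n + 1"] row[of "20 * p + 12 + 2 * int n + 2"]
      G'(6)[of "20 * p + 12 + 2 * int n + 1" "20 * c + 6"]
      G'(6)[of "20 * p + 12 + 2 * int n + 2" "20 * c + 6"]
      by (simp add: gstep_def)
  qed
  show "\<exists>d. node d \<and> hv d \<and> par d = c \<and> n = nat (10 * (d - p) - 3)"
    if st: "gstep h Black (20 * p + 12 + 2 * int n, 20 * c + 6) True"
  proof -
    have n: "2 \<le> n"
    proof (rule ccontr)
      assume "\<not> 2 \<le> n"
      then consider "n = 0" | "n = 1" by linarith
      then show False using st G'(4,5) by cases (auto simp: gstep_def add.commute)
    qed
    then have "base hv (20 * p + 12 + 2 * int n, 20 * c + 7) = Some Red"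
      using st G'(6)[of "20 * p + 12 + 2 * int n" "20 * c + 7"] by (simp add: gstep_def add.commute)
    then obtain d where "node d" "hv d" "par d = c" "20 * p + 12 + 2 * int n = 20 * d + 6"
      using base_above_row[of c hv "20 * p + 12 + 2 * int n"] c n p by auto
    then show ?thesis by (intro exI[of _ d]) auto
  qed
  assume d: "node d" "hv d" "par d = c"
  have dp: "p + 2 \<le> d" using d c par_less[of d] par_less[of c] p by linarith
  have H: "h (20 * d + u, 20 * c + v) = pat u v" if "0 \<le> u" "u < 20" "7 \<le> v" "v < 17" for u v
    using G'(6)[of "20 * d + u" "20 * c + v"] base_gadget[of d hv u v] d that dp by simp
  show "gstep h Black (20 * d + 6, 20 * c + 6 + 2 * k) True" if k: "0 \<le> k" "k < 4"
  proof -
    have "k = 0 \<or> k = 1 \<or> k = 2 \<or> k = 3" using k by arith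
    then show ?thesis using H[of 6 7] H[of 6 8] H[of 6 9] H[of 6 10] H[of 6 11] H[of 6 12]
        H[of 6 13] H[of 6 14]
      by (auto simp: gstep_def pat_def add.commute)
  qed
  show "\<not> gstep h Black (20 * d + 6, 20 * c + 6 + 2 * k) False" if k: "0 < k" "k \<le> 4"
  proof -
    have "k = 1 \<or> k = 2 \<or> k = 3 \<or> k = 4" using k by arith
    then show ?thesis using H[of 7 8] H[of 7 10] H[of 7 12] H[of 7 14]
      by (auto simp: gstep_def pat_def add.commute)
  qed
  show "\<not> gstep h Black (20 * d + 6, 20 * c + 14) True"
    using H[of 6 16] by (auto simp: gstep_def pat_def add.commute)
qed

text \<open>Stated for prefixes, so that it serves finite and infinite runs alike: a prefix is
  straight, or it has turned at a child and has made at most four jumps upwards.\<close>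

lemma GoodR_walk:
  assumes G: "GoodR hv c h" and c: "node c" "\<not> hv c" and p: "p = par c"
    and walk: "\<And>i. i < n \<Longrightarrow> gstep h Black (wpos Black ds (20 * p + 12, 20 * c + 6) i) (ds i)"
  shows "(\<forall>j<n. \<not> ds j) \<or> (\<exists>d. node d \<and> hv d \<and> par d = c \<and> nat (10 * (d - p) - 3) < n \<and>
    n \<le> nat (10 * (d - p) - 3) + 4 \<and> (\<forall>j<n. ds j \<longleftrightarrow> nat (10 * (d - p) - 3) \<le> j))"
  using walk
proof (induction n)
  case (Suc n)
  note st = GoodR_steps[OF G c p]
  let ?S = "(20 * p + 12, 20 * c + 6)"
  have s: "gstep h Black (wpos Black ds ?S n) (ds n)" using Suc.prems[of n] by simp
  from Suc.IH Suc.prems have "(\<forall>j<n. \<not> ds j) \<or> (\<exists>d. node d \<and> hv d \<and> par d = c \<and> nat (10 * (d - p) - 3) < n \<and>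
    n \<le> nat (10 * (d - p) - 3) + 4 \<and> (\<forall>j<n. ds j \<longleftrightarrow> nat (10 * (d - p) - 3) \<le> j))"
    by auto
  then show ?case
  proof
    assume straight: "\<forall>j<n. \<not> ds j"
    show ?thesis
    proof (cases "ds n")
      case False
      then show ?thesis using straight by (auto simp: less_Suc_eq)
    next
      case True
      have "gstep h Black (20 * p + 12 + 2 * int n, 20 * c + 6) True"
        using s True straight by (simp add: wpos_straight)
      from st(2)[OF this] obtain d where "node d" "hv d" "par d = c" "n = nat (10 * (d - p) - 3)"
        by blast
      then show ?thesis using straight True by (intro disjI2 exI[of _ d]) (auto simp: less_Suc_eq)
    qed
  next
    assume "\<exists>d. node d \<and> hv d \<and> par d = c \<and> nat (10 * (d - p) - 3) < n \<and>
      n \<le> nat (10 * (d - p) - 3) + 4 \<and> (\<forall>j<n. ds j \<longleftrightarrow> nat (10 * (d - p) - 3) \<le> j)"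
    then obtain d N where d: "node d" "hv d" "par d = c" and N: "N = nat (10 * (d - p) - 3)"
      "N < n" "n \<le> N + 4" "\<forall>j<n. ds j \<longleftrightarrow> N \<le> j" by blast
    have "wpos Black ds ?S n = wpos Black (\<lambda>i. N \<le> i) ?S n"
      using N(4) by (intro wpos_cong) auto
    also have "\<dots> = (20 * p + 12 + 2 * int N, 20 * c + 6 + 2 * int (n - N))"
      using N(2) by (simp add: wpos_turn)
    also have "20 * p + 12 + 2 * int N = 20 * d + 6"
      using N(1) d c par_less[of d] par_less[of c] p by simp
    finally have w: "wpos Black ds ?S n = (20 * d + 6, 20 * c + 6 + 2 * int (n - N))" .
    have "\<not> gstep h Black (wpos Black ds ?S n) False"
      unfolding w by (rule st(4)[OF d]) (use N(2,3) in auto)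
    then have "ds n" using s by (cases "ds n") auto
    \<comment> \<open>The occupied square (6, 16) of the gadget prevents a fifth jump upwards over
      (6, 15).\<close>
    moreover have "n \<noteq> N + 4" using st(5)[OF d] s \<open>ds n\<close> unfolding w by (auto simp: add.commute)
    ultimately show ?thesis using d N by (intro disjI2 exI[of _ d]) (auto simp: less_Suc_eq)
  qed
qed auto

lemma GoodR_Black_start:
  assumes "GoodR hv c h" "h s = Some Black" "gstep h Black s d"
  shows "s = (20 * par c + 12, 20 * c + 6)"
proof -
  have "s = (20 * par c + 12, 20 * c + 6) \<or> guarded h s"
    using assms(1,2) by (auto simp: GoodR_def Let_def Safe_def)
  then show ?thesis using guarded_no_gstep assms(3) by blast
qed

lemma GoodR_canjump:
  assumes "GoodR hv c h" "node c" "\<not> hv c"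
  shows "gcanjump h Black"
  using GoodR_steps(1)[OF assms HOL.refl, of 0] assms(1) unfolding gcanjump_def
  by (auto simp: GoodR_def Let_def)

lemma GoodR_hinf:
  assumes G: "GoodR hv c h" and c: "node c" "\<not> hv c"
  shows "gmove h Black (hinf c h)"
proof -
  have "h (20 * par c + 12, 20 * c + 6) = Some Black" using G by (auto simp: GoodR_def Let_def)
  moreover have "gstep h Black (wpos Black (\<lambda>_. False) (20 * par c + 12, 20 * c + 6) i) False" for i
    using GoodR_steps(1)[OF G c HOL.refl, of i] by (simp add: wpos_straight)
  ultimately have "ginfm h Black (hinf c h)"
    unfolding ginfm_def hinf_def by (intro exI conjI) auto
  then show ?thesis using GoodR_canjump[OF assms] by (auto simp: gmove_def)
qed

lemma GoodR_hexit:
  assumes G: "GoodR hv c h" and c: "node c" "\<not> hv c" and d: "node d" "hv d" "par d = c"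
  shows "gmove h Black (hexit c d h)"
proof -
  define p where p: "p = par c"
  define N where N: "N = nat (10 * (d - p) - 3)"
  note st = GoodR_steps[OF G c p]
  have Nd: "20 * p + 12 + 2 * int N = 20 * d + 6"
    using N d c par_less[of d] par_less[of c] p by simp
  let ?S = "(20 * p + 12, 20 * c + 6)"
  have w: "wpos Black (\<lambda>i. N \<le> i) ?S i =
    (if i \<le> N then (20 * p + 12 + 2 * int i, 20 * c + 6) else (20 * d + 6, 20 * c + 6 + 2 * int (i - N)))" for i
    unfolding wpos_turn using Nd by auto
  have "gstep h Black (wpos Black (\<lambda>i. N \<le> i) ?S i) (N \<le> i)" if "i < N + 4" for i
  proof (cases "N \<le> i")
    case True
    have "wpos Black (\<lambda>i. N \<le> i) ?S i = (20 * d + 6, 20 * c + 6 + 2 * int (i - N))"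
      using w[of i] True Nd by auto
    then show ?thesis using st(3)[OF d, of "int (i - N)"] that True by simp
  next
    case False
    then show ?thesis using st(1)[of i] by (simp add: w)
  qed
  moreover have "wpos Black (\<lambda>i. N \<le> i) ?S (N + 4) = (20 * d + 6, 20 * c + 6 + 2 * 4)"
    using w[of "N + 4"] by simp
  then have "\<not> gstep h Black (wpos Black (\<lambda>i. N \<le> i) ?S (N + 4)) e" for e
    using st(4)[OF d, of 4] st(5)[OF d] by (cases e) (simp_all add: add.commute)
  moreover have "h ?S = Some Black" using G p by (auto simp: GoodR_def Let_def)
  ultimately have "gfin h Black (hexit c d h)"
    unfolding gfin_def hexit_def Let_def p[symmetric] N[symmetric]
    by (intro exI[of _ ?S] exI[of _ "\<lambda>i. N \<le> i"] exI[of _ "N + 4"]) auto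
  then show ?thesis using GoodR_canjump[OF G c] by (auto simp: gmove_def)
qed

lemma GoodR_moves:
  assumes G: "GoodR hv c h" and c: "node c" "\<not> hv c" and m: "gmove h Black h'"
  shows "h' = hinf c h \<or> (\<exists>d. node d \<and> hv d \<and> par d = c \<and> h' = hexit c d h)"
proof -
  define p where p: "p = par c"
  note st = GoodR_steps[OF G c p] and walk = GoodR_walk[OF G c p]
  let ?S = "(20 * p + 12, 20 * c + 6)"
  have start: "s = ?S" if "h s = Some Black" "gstep h Black s e" for s e
    using GoodR_Black_start[OF G that] p by simp
  consider "gfin h Black h'" | "ginfm h Black h'"
    using m GoodR_canjump[OF G c] by (auto simp: gmove_def)
  then show ?thesis
  proof cases
    case 1
    then obtain s ds n where *: "h s = Some Black" "0 < n"
      "\<And>i. i < n \<Longrightarrow> gstep h Black (wpos Black ds s i) (ds i)"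
      "\<And>d. \<not> gstep h Black (wpos Black ds s n) d" "h' = gst h Black ds s n"
      unfolding gfin_def by blast
    have s: "s = ?S" using start *(1) *(3)[of 0] *(2) by auto
    have "\<not> (\<forall>j<n. \<not> ds j)"
    proof
      assume "\<forall>j<n. \<not> ds j"
      then have "wpos Black ds s n = (20 * p + 12 + 2 * int n, 20 * c + 6)"
        unfolding s by (intro wpos_straight) auto
      then show False using *(4)[of False] st(1)[of n] by simp
    qed
    then obtain d N where d: "node d" "hv d" "par d = c" and N: "N = nat (10 * (d - p) - 3)"
      "N < n" "n \<le> N + 4" "\<forall>j<n. ds j \<longleftrightarrow> N \<le> j"
      using walk[of n ds] *(3) unfolding s by blast
    have "wpos Black ds ?S n = wpos Black (\<lambda>i. N \<le> i) ?S n"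
      using N(4) by (intro wpos_cong) auto
    also have "\<dots> = (20 * p + 12 + 2 * int N, 20 * c + 6 + 2 * int (n - N))"
      using N(2) by (simp add: wpos_turn)
    also have "20 * p + 12 + 2 * int N = 20 * d + 6"
      using N(1) d c par_less[of d] par_less[of c] p by simp
    finally have "\<not> gstep h Black (20 * d + 6, 20 * c + 6 + 2 * int (n - N)) True"
      using *(4) s by simp
    moreover have "gstep h Black (20 * d + 6, 20 * c + 6 + 2 * int (n - N)) True" if "n \<noteq> N + 4"
      by (rule st(3)[OF d]) (use N(2,3) that in auto)
    ultimately have "n = N + 4" by blast
    moreover have "gst h Black ds ?S n = gst h Black (\<lambda>i. N \<le> i) ?S n"
      using N(4) by (intro gst_cong) auto
    ultimately have "h' = hexit c d h"
      using *(5) s unfolding hexit_def Let_def p[symmetric] N(1)[symmetric] by simp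
    then show ?thesis using d by blast
  next
    case 2
    then obtain s ds where *: "h s = Some Black"
      "\<And>i. gstep h Black (wpos Black ds s i) (ds i)" "h' = ginf h Black ds s"
      unfolding ginfm_def by blast
    have s: "s = ?S" using start *(1) *(2)[of 0] by auto
    have "\<not> ds j" for j
    proof
      assume "ds j"
      obtain d where d: "\<forall>i<Suc j. ds i \<longleftrightarrow> nat (10 * (d - p) - 3) \<le> i"
        using walk[of "Suc j" ds] *(2) \<open>ds j\<close> unfolding s by blast
      \<comment> \<open>A prefix with five jumps from index \<open>j\<close> on is too long: the
        turn occurs at or before \<open>j\<close>, and only four jumps upwards are possible.\<close>
      obtain d' where d': "j + 5 \<le> nat (10 * (d' - p) - 3) + 4"
          "\<forall>i<j + 5. ds i \<longleftrightarrow> nat (10 * (d' - p) - 3) \<le> i"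
        using walk[of "j + 5" ds] *(2) \<open>ds j\<close> unfolding s by auto
      have "nat (10 * (d' - p) - 3) \<le> j" using d'(2) \<open>ds j\<close> by auto
      then show False using d'(1) by simp
    qed
    then have "ds = (\<lambda>_. False)" by auto
    then show ?thesis using *(3) s p by (simp add: hinf_def)
  qed
qed

lemma hinf_apply:
  "hinf c h x = (if x = (20 * par c + 12, 20 * c + 6) \<or>
     (\<exists>a. x = (a, 20 * c + 6) \<and> odd a \<and> 20 * par c + 12 < a) then None else h x)"
proof -
  have "(\<exists>i. x = wmid Black (\<lambda>_. False) (20 * par c + 12, 20 * c + 6) i) \<longleftrightarrow>
     (\<exists>a. x = (a, 20 * c + 6) \<and> odd a \<and> 20 * par c + 12 < a)" (is "?L \<longleftrightarrow> ?R")
  proof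
    assume ?L
    then show ?R by (auto simp: wmid_def wpos_straight)
  next
    assume ?R
    then obtain a where a: "x = (a, 20 * c + 6)" "odd a" "20 * par c + 12 < a" by blast
    obtain k where k: "a = 2 * k + 1" using a(2) by (rule oddE)
    \<comment> \<open>The index solves \<open>2 * k + 1 = 20 * par c + 13 + 2 * i\<close>.\<close>
    then have "a = 20 * par c + 12 + 2 * int (nat (k - 10 * par c - 6)) + 1" using a(3) by simp
    then show ?L using a(1)
      by (intro exI[of _ "nat (k - 10 * par c - 6)"]) (simp add: wmid_def wpos_straight)
  qed
  then show ?thesis unfolding hinf_def ginf_def by simp
qed

lemma hexit_apply:
  assumes c: "node c" and d: "node d" "par d = c"
  shows "hexit c d h x = (if x = (20 * d + 6, 20 * c + 14) then Some Black
     else if x = (20 * par c + 12, 20 * c + 6) \<or>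
       (\<exists>a. x = (a, 20 * c + 6) \<and> odd a \<and> 20 * par c + 12 < a \<and> a < 20 * d + 6) \<or>
       x \<in> {(20 * d + 6, 20 * c + 7), (20 * d + 6, 20 * c + 9), (20 * d + 6, 20 * c + 11),
         (20 * d + 6, 20 * c + 13)} then None else h x)"
proof -
  define p where p: "p = par c"
  define N where N: "N = nat (10 * (d - p) - 3)"
  have Nd: "20 * p + 12 + 2 * int N = 20 * d + 6"
    using N d c par_less[of d] par_less[of c] p by simp
  let ?S = "(20 * p + 12, 20 * c + 6)"
  have w: "wpos Black (\<lambda>i. N \<le> i) ?S i =
    (if i \<le> N then (20 * p + 12 + 2 * int i, 20 * c + 6) else (20 * d + 6, 20 * c + 6 + 2 * int (i - N)))" for i
    unfolding wpos_turn using Nd by auto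
  have m: "wmid Black (\<lambda>i. N \<le> i) ?S i =
    (if i < N then (20 * p + 13 + 2 * int i, 20 * c + 6) else (20 * d + 6, 20 * c + 7 + 2 * int (i - N)))" for i
    unfolding wmid_def w using Nd by auto
  have "(\<exists>i<N+4. x = wmid Black (\<lambda>i. N \<le> i) ?S i) \<longleftrightarrow>
     (\<exists>a. x = (a, 20 * c + 6) \<and> odd a \<and> 20 * p + 12 < a \<and> a < 20 * d + 6) \<or>
       x \<in> {(20 * d + 6, 20 * c + 7), (20 * d + 6, 20 * c + 9), (20 * d + 6, 20 * c + 11),
         (20 * d + 6, 20 * c + 13)}" (is "?L \<longleftrightarrow> ?R")
  proof
    assume ?L
    then obtain i where i: "i < N + 4" "x = wmid Black (\<lambda>i. N \<le> i) ?S i" by blast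
    show ?R
    proof (cases "i < N")
      case True
      then show ?thesis using i Nd by (simp add: m)
    next
      case False
      then have "i = N \<or> i = N + 1 \<or> i = N + 2 \<or> i = N + 3" using i by arith
      then show ?thesis using i(2) by (auto simp: m)
    qed
  next
    assume ?R
    then show ?L
    proof
      assume "\<exists>a. x = (a, 20 * c + 6) \<and> odd a \<and> 20 * p + 12 < a \<and> a < 20 * d + 6"
      then obtain a where a: "x = (a, 20 * c + 6)" "odd a" "20 * p + 12 < a" "a < 20 * d + 6" by blast
      obtain k where k: "a = 2 * k + 1" using a(2) by (rule oddE)
      define i where "i = nat (k - 10 * p - 6)"
      have e: "a = 20 * p + 13 + 2 * int i" using k a(3) unfolding i_def by simp
      then have "i < N" using Nd a(4) by linarith
      then show ?L using a(1) e by (intro exI[of _ i]) (simp add: m)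
    next
      assume "x \<in> {(20 * d + 6, 20 * c + 7), (20 * d + 6, 20 * c + 9), (20 * d + 6, 20 * c + 11),
         (20 * d + 6, 20 * c + 13)}"
      then have "x = wmid Black (\<lambda>i. N \<le> i) ?S (N + 0) \<or> x = wmid Black (\<lambda>i. N \<le> i) ?S (N + 1) \<or>
        x = wmid Black (\<lambda>i. N \<le> i) ?S (N + 2) \<or> x = wmid Black (\<lambda>i. N \<le> i) ?S (N + 3)"
        by (auto simp: m)
      moreover have "N + 0 < N + 4" "N + 1 < N + 4" "N + 2 < N + 4" "N + 3 < N + 4" by auto
      ultimately show ?L by blast
    qed
  qed
  then show ?thesis
    unfolding hexit_def Let_def p[symmetric] N[symmetric] gst_def w[of "N + 4"] by auto
qed

end

lemma forced_run:
  assumes "h (a, b) = Some Black"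
    and start: "\<And>s e. h s = Some Black \<Longrightarrow> gstep h Black s e \<Longrightarrow> s = (a, b)"
    and "0 < n"
    and right: "\<And>i. i < n \<Longrightarrow> gstep h Black (a + 2 * int i, b) False"
    and up: "\<And>i. i < n \<Longrightarrow> \<not> gstep h Black (a + 2 * int i, b) True"
    and stop: "\<And>e. \<not> gstep h Black (a + 2 * int n, b) e"
  shows "gmove h Black h' \<longleftrightarrow> h' = gst h Black (\<lambda>_. False) (a, b) n"
proof -
  have walk: "(\<forall>i<m. \<not> ds i) \<and> m \<le> n"
    if "\<And>i. i < m \<Longrightarrow> gstep h Black (wpos Black ds (a, b) i) (ds i)" for ds m
    using that
  proof (induction m)
    case (Suc m)
    then have IH: "\<forall>i<m. \<not> ds i" "m \<le> n" by auto
    then have "wpos Black ds (a, b) m = (a + 2 * int m, b)" by (intro wpos_straight) auto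
    then have s: "gstep h Black (a + 2 * int m, b) (ds m)" using Suc.prems[of m] by simp
    then have "m \<noteq> n" using stop by blast
    then have "m < n" using IH(2) by simp
    moreover have "\<not> ds m" using up[OF \<open>m < n\<close>] s by (cases "ds m") auto
    ultimately show ?case using IH by (auto simp: less_Suc_eq)
  qed auto
  have can: "gcanjump h Black" using right[of 0] assms(1,3) unfolding gcanjump_def by auto
  have inf: "\<not> ginfm h Black h'"
  proof
    assume "ginfm h Black h'"
    then obtain s ds where *: "h s = Some Black" "\<And>i. gstep h Black (wpos Black ds s i) (ds i)"
      unfolding ginfm_def by blast
    have "s = (a, b)" using start *(1) *(2)[of 0] by auto
    then show False using walk[of "Suc n" ds] *(2) by auto
  qed
  have "gfin h Black h' \<longleftrightarrow> h' = gst h Black (\<lambda>_. False) (a, b) n"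
  proof
    assume "gfin h Black h'"
    then obtain s ds m where *: "h s = Some Black" "0 < m"
      "\<And>i. i < m \<Longrightarrow> gstep h Black (wpos Black ds s i) (ds i)"
      "\<And>e. \<not> gstep h Black (wpos Black ds s m) e" "h' = gst h Black ds s m"
      unfolding gfin_def by blast
    have s: "s = (a, b)" using start *(1) *(3)[of 0] *(2) by auto
    have w: "\<forall>i<m. \<not> ds i" "m \<le> n" using walk[of m ds] *(3) s by auto
    then have "wpos Black ds s m = (a + 2 * int m, b)" unfolding s by (intro wpos_straight) auto
    then have "\<not> m < n" using *(4)[of False] right[of m] by auto
    then have "m = n" using w by simp
    then show "h' = gst h Black (\<lambda>_. False) (a, b) n"
      using *(5) w(1) unfolding s by (auto intro!: gst_cong)
  next
    assume h': "h' = gst h Black (\<lambda>_. False) (a, b) n"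
    have "wpos Black (\<lambda>_. False) (a, b) i = (a + 2 * int i, b)" for i
      by (intro wpos_straight) auto
    then show "gfin h Black h'" unfolding gfin_def h' using assms
      by (intro exI[of _ "(a, b)"] exI[of _ "\<lambda>_. False"] exI[of _ n]) auto
  qed
  then show ?thesis using can inf unfolding gmove_def by simp
qed

lemma gst_4: "gst h Black (\<lambda>_. False) (a, b) 4 x =
    (if x = (a + 8, b) then Some Black
     else if x \<in> {(a, b), (a + 1, b), (a + 3, b), (a + 5, b), (a + 7, b)} then None else h x)"
proof -
  have w: "wpos Black (\<lambda>_. False) (a, b) i = (a + 2 * int i, b)" for i
    by (intro wpos_straight) auto
  have "(\<exists>i<4. P i) \<longleftrightarrow> P 0 \<or> P 1 \<or> P 2 \<or> P (3::nat)" for P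
    by (auto simp: numeral_eq_Suc less_Suc_eq)
  then show ?thesis by (auto simp: gst_def w wmid_def)
qed

section \<open>Red's replies and the next release\<close>

lemma red_target_in_guards: "mv Red e 1 q \<in> guards q"
  by (cases q) (auto simp: guards_def)

lemma red_target_le: "fst (mv Red e 1 q) \<le> fst q \<and> snd (mv Red e 1 q) \<le> snd q"
  by (cases q) auto

context tree_board
begin

lemma GoodR_facts:
  assumes "GoodR hv c h"
  shows "h (20 * par c + 12, 20 * c + 6) = Some Black"
    and "\<And>a b. 20 * par c + 15 \<le> a \<Longrightarrow> 20 * c + 6 \<le> b \<Longrightarrow> h (a, b) = base hv (a, b)"
    and "\<And>s. h s = Some Black \<Longrightarrow> base hv s = Some Black"
    and "\<And>s. h s = Some Black \<Longrightarrow> s \<noteq> (20 * par c + 12, 20 * c + 6) \<Longrightarrow> guarded h s"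
    and "lone h"
  using assms by (auto simp: GoodR_def Let_def Safe_def)

text \<open>The vanished runner has emptied only its start and odd columns of its row, so all
  remaining black pawns are still guarded. Red makes the spare move and Black is blocked.\<close>

lemma hinf_reply:
  assumes G: "GoodR hv c h" and c: "node c"
  shows "\<exists>h2. gmove (hinf c h) Red h2 \<and> (\<forall>h3. \<not> gmove h2 Black h3)"
proof -
  note F = GoodR_facts[OF G]
  let ?h = "hinf c h"
  have c0: "0 < c" "0 \<le> par c" using c par_pos par_nonneg by auto
  have lone: "lone ?h" using F(5) c0 unfolding lone_def hinf_apply by auto
  have black: "h s = Some Black" "s \<noteq> (20 * par c + 12, 20 * c + 6)" if "?h s = Some Black" for s
    using that by (auto simp: hinf_apply split: if_splits)
  have guarded: "guarded ?h s" if s: "?h s = Some Black" for s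
    unfolding guarded_def
  proof
    fix t assume t: "t \<in> guards s"
    have "h t \<noteq> None" using F(4) black[OF s] t by (auto simp: guarded_def)
    moreover have "t \<noteq> (20 * par c + 12, 20 * c + 6)"
      using guards_start F(3) black[OF s] t by blast
    moreover have "\<not> (\<exists>a. t = (a, 20 * c + 6) \<and> odd a)"
      using guards_row F(3) black[OF s] t by blast
    ultimately show "?h t \<noteq> None" by (auto simp: hinf_apply)
  qed
  have "\<not> gcanjump ?h Red" by (rule red_no_jump) (use guarded guarded_safe in blast)
  moreover define h2 where "h2 = ?h((-7, -10) := None, (-8, -10) := Some Red)"
  have "gsimple ?h Red h2"
    unfolding gsimple_def using lone
    by (intro exI[of _ "(-7, -10)"] exI[of _ False]) (auto simp: lone_def h2_def)
  ultimately have "gmove ?h Red h2" by (simp add: gmove_def)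
  moreover have "guarded h2 s" if "h2 s = Some Black" for s
    unfolding guarded_def
  proof
    fix t assume t: "t \<in> guards s"
    have s: "?h s = Some Black" using that by (auto simp: h2_def split: if_splits)
    have "?h t \<noteq> None" using guarded[OF s] t by (auto simp: guarded_def)
    moreover have "t \<noteq> (-7, -10)"
      using guards_nonneg[of hv s "-7" "-10"] F(3) black[OF s] t by auto
    ultimately show "h2 t \<noteq> None" by (auto simp: h2_def)
  qed
  then have "\<not> gmove h2 Black h3" for h3 by (intro guarded_no_gmove) auto
  ultimately show ?thesis by blast
qed

text \<open>The runner is stuck on (6, 14) of the gadget of \<open>d\<close>, and the piece on (6,
  15) captures it, landing on (6, 13). The runner has emptied (6, 11), the first landing square of
  the relay pawn.\<close>

lemma hexit_reply:
  assumes G: "GoodR hv c h" and c: "node c" "\<not> hv c" and d: "node d" "hv d" "par d = c"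
  shows "\<exists>h2. (\<forall>h''. gmove (hexit c d h) Red h'' \<longleftrightarrow> h'' = h2) \<and> GoodI hv d h2"
proof -
  note F = GoodR_facts[OF G]
  let ?h = "hexit c d h"
  let ?S = "(20 * par c + 12, 20 * c + 6)"
  let ?T = "(20 * d + 6, 20 * c + 14)"
  note app = hexit_apply[OF c(1) d(1,3), of h]
  have c0: "0 < c" "0 \<le> par c" "0 < d" "par c + 2 \<le> d"
    using c d par_pos par_nonneg par_less[of c] par_less[of d] by auto
  have H: "h (20 * d + u, 20 * c + v) = pat u v" if "0 \<le> u" "u < 20" "7 \<le> v" "v < 17" for u v
    using F(2)[of "20 * d + u" "20 * c + v"] base_gadget[of d hv u v] d that c0 by simp
  have black: "h s = Some Black" "s \<noteq> ?S" "base hv s = Some Black" "guarded h s"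
    if "?h s = Some Black" "s \<noteq> ?T" for s
    using that F(3,4) by (auto simp: app split: if_splits)
  define h2 where "h2 = (\<lambda>x. if x = mv Red True 1 ?T then Some Red
     else if x = mv Red True (-1) ?T \<or> x = ?T then None else ?h x)"
  have h2_app: "h2 x = (if x = (20 * d + 6, 20 * c + 13) then Some Red
     else if x \<in> {(20 * d + 6, 20 * c + 15), ?T, ?S, (20 * d + 6, 20 * c + 7), (20 * d + 6, 20 * c + 9),
        (20 * d + 6, 20 * c + 11)} \<or> (\<exists>a. x = (a, 20 * c + 6) \<and> odd a \<and> 20 * par c + 12 < a \<and> a < 20 * d + 6)
     then None else h x)" for x
    unfolding h2_def app by auto
  have reply: "gmove ?h Red h'' \<longleftrightarrow> h'' = h2" for h''
    unfolding h2_def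
  proof (rule red_reply)
    show "?h ?T = Some Black" by (simp add: app)
    show "?h (mv Red True (-1) ?T) = Some Red" using H[of 6 15] by (simp add: app pat_def add.commute)
    show "?h (mv Red True 1 ?T) = None" by (simp add: app)
    show "?h (mv Red (\<not> True) 1 ?T) \<noteq> None" if "?h (mv Red (\<not> True) (-1) ?T) = Some Red"
      using that H[of 7 14] by (simp add: app pat_def add.commute)
    fix q e assume q: "?h q = Some Black" "q \<noteq> ?T"
    let ?t = "mv Red e 1 q"
    note b = black[OF q]
    have t: "?t \<in> guards q" by (rule red_target_in_guards)
    have "h ?t \<noteq> None" using b(4) t by (auto simp: guarded_def)
    moreover have "?t \<noteq> ?S" using guards_start b(3) t by metis
    moreover have "\<not> (\<exists>a. ?t = (a, 20 * c + 6) \<and> odd a)"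
      using guards_row b(2,3) t by metis
    \<comment> \<open>A pawn with a guard in this column stands two columns to its left, but Red's
      landing square is never to the right of the captured pawn.\<close>
    moreover have "?t \<noteq> (20 * d + 6, y)" for y
    proof
      assume y: "?t = (20 * d + 6, y)"
      then have "q = (20 * d + 4, y)" using guards_exit b(3) t by metis
      then show False using red_target_le[of e q] y by simp
    qed
    ultimately show "?h ?t \<noteq> None" unfolding app by auto
  qed
  have "GoodI hv d h2"
    unfolding GoodI_def Let_def d(3)
  proof (intro conjI allI impI)
    show "h2 (20 * d + 6, 20 * c + 11) = None" by (simp add: h2_app)
    show "h2 (20 * d + 6, 20 * c + 12) \<noteq> Some Red" using H[of 6 12] by (simp add: h2_app pat_def)
    show "lone h2" using F(5) c0 unfolding lone_def h2_app by auto
    show "h2 (a, b) = base hv (a, b)"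
      if "20 * d + 3 \<le> a" "20 * c + 7 \<le> b" "a \<noteq> 20 * d + 6" for a b
      using that F(2)[of a b] c0 by (auto simp: h2_app)
    show "Safe hv h2 {(20 * d + 4, 20 * c + 11)}"
      unfolding Safe_def
    proof (intro allI impI)
      fix s assume "h2 s = Some Black"
      then have s: "?h s = Some Black" "s \<noteq> ?T" by (auto simp: h2_def split: if_splits)
      note b = black[OF s]
      have "guarded h2 s" if ns: "s \<noteq> (20 * d + 4, 20 * c + 11)"
        unfolding guarded_def
      proof
        fix t assume t: "t \<in> guards s"
        have "h t \<noteq> None" using b(4) t by (auto simp: guarded_def)
        moreover have "t \<noteq> ?S" using guards_start b(3) t by metis
        moreover have "\<not> (\<exists>a. t = (a, 20 * c + 6) \<and> odd a)"
          using guards_row b(2,3) t by metis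
        moreover have "t \<noteq> (20 * d + 6, 20 * c + y)" if "y \<in> {7, 9, 11, 14, 15}" for y
        proof
          assume y: "t = (20 * d + 6, 20 * c + y)"
          then have s: "s = (20 * d + 4, 20 * c + y)" using guards_exit b(3) t by metis
          \<comment> \<open>Among these rows only 11 has a black pawn in column 4, the relay pawn
            excluded by \<open>ns\<close>.\<close>
          then have "pat 4 y = Some Black" using b(3) base_gadget[of d hv 4 y] d that by auto
          then show False using ns s by (auto simp: pat_def split: if_splits)
        qed
        ultimately show "h2 t \<noteq> None" unfolding h2_app by auto
      qed
      then show "base hv s = Some Black \<and> (s \<in> {(20 * d + 4, 20 * c + 11)} \<or> guarded h2 s)"
        using b by auto
    qed
  qed
  then show ?thesis using reply by blast
qed

text \<open>The relay pawn jumps from (4, 11) to (12, 11), where the pair (13, 11), (14, 11) stops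
  it and (13, 11) recaptures. Having captured on (9, 11), it has freed the landing square of the
  runner on (9, 9). The mirror image of the result is again the situation of a horizontal
  runner.\<close>

lemma GoodI_reply:
  assumes G: "GoodI hv d h" and d: "node d" "hv d"
  shows "\<exists>h3 h4. (\<forall>h'. gmove h Black h' \<longleftrightarrow> h' = h3) \<and> (\<forall>h'. gmove h3 Red h' \<longleftrightarrow> h' = h4) \<and>
    GoodR (Not \<circ> hv) d (h4 \<circ> tau)"
proof -
  define p where p: "p = par d"
  have G': "h (20 * d + 6, 20 * p + 11) = None" "h (20 * d + 6, 20 * p + 12) \<noteq> Some Red"
     "\<And>a b. 20 * d + 3 \<le> a \<Longrightarrow> 20 * p + 7 \<le> b \<Longrightarrow> a \<noteq> 20 * d + 6 \<Longrightarrow> h (a, b) = base hv (a, b)"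
     "\<And>s. h s = Some Black \<Longrightarrow> base hv s = Some Black"
     "\<And>s. h s = Some Black \<Longrightarrow> s \<noteq> (20 * d + 4, 20 * p + 11) \<Longrightarrow> guarded h s" "lone h"
    using G unfolding GoodI_def Let_def p[symmetric] Safe_def by auto
  have d0: "0 < d" "0 \<le> p" using d p par_pos par_nonneg by auto
  have H: "h (20 * d + u, 20 * p + v) = pat u v" if "3 \<le> u" "u < 20" "7 \<le> v" "v < 17" "u \<noteq> 6" for u v
    using G'(3)[of "20 * d + u" "20 * p + v"] base_gadget[of d hv u v] d that p by simp
  let ?I = "(20 * d + 4, 20 * p + 11)"
  let ?D = "(20 * d + 9, 20 * p + 9)"
  let ?T = "(20 * d + 12, 20 * p + 11)"
  define h3 where "h3 = gst h Black (\<lambda>_. False) ?I 4"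
  have app: "h3 x = (if x = ?T then Some Black
     else if x \<in> {?I, (20 * d + 5, 20 * p + 11), (20 * d + 7, 20 * p + 11), (20 * d + 9, 20 * p + 11),
       (20 * d + 11, 20 * p + 11)} then None else h x)" for x
    unfolding h3_def gst_4 by (simp add: add.assoc)
  have move: "gmove h Black h' \<longleftrightarrow> h' = h3" for h'
    unfolding h3_def
  proof (rule forced_run)
    show "h ?I = Some Black" using H[of 4 11] by (simp add: pat_def)
    show "s = ?I" if "h s = Some Black" "gstep h Black s e" for s e
      using G'(5) that guarded_no_gstep by blast
    show "gstep h Black (20 * d + 4 + 2 * int i, 20 * p + 11) False" if "i < 4" for i
    proof -
      have "i = 0 \<or> i = 1 \<or> i = 2 \<or> i = 3" using that by arith
      then show ?thesis using G'(1) H[of 5 11] H[of 7 11] H[of 8 11] H[of 9 11] H[of 10 11]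
          H[of 11 11] H[of 12 11]
        by (auto simp: gstep_def pat_def add.commute)
    qed
    show "\<not> gstep h Black (20 * d + 4 + 2 * int i, 20 * p + 11) True" if "i < 4" for i
    proof -
      have "i = 0 \<or> i = 1 \<or> i = 2 \<or> i = 3" using that by arith
      then show ?thesis using G'(2) H[of 4 13] H[of 8 12] H[of 10 12]
        by (auto simp: gstep_def pat_def add.commute)
    qed
    show "\<not> gstep h Black (20 * d + 4 + 2 * int 4, 20 * p + 11) e" for e
      using H[of 14 11] H[of 12 12] by (cases e) (auto simp: gstep_def pat_def add.commute)
  qed auto
  have black: "h s = Some Black" "s \<noteq> ?I" "base hv s = Some Black" "guarded h s"
    if "h3 s = Some Black" "s \<noteq> ?T" for s
    using that G'(4,5) by (auto simp: app split: if_splits)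
  define h4 where "h4 = (\<lambda>x. if x = mv Red False 1 ?T then Some Red
     else if x = mv Red False (-1) ?T \<or> x = ?T then None else h3 x)"
  have h4_app: "h4 x = (if x = (20 * d + 11, 20 * p + 11) then Some Red
     else if x \<in> {?I, (20 * d + 5, 20 * p + 11), (20 * d + 7, 20 * p + 11), (20 * d + 9, 20 * p + 11),
       ?T, (20 * d + 13, 20 * p + 11)} then None else h x)" for x
    unfolding h4_def app by auto
  have reply: "gmove h3 Red h' \<longleftrightarrow> h' = h4" for h'
    unfolding h4_def
  proof (rule red_reply)
    show "h3 ?T = Some Black" by (simp add: app)
    show "h3 (mv Red False (-1) ?T) = Some Red" using H[of 13 11] by (simp add: app pat_def add.commute)
    show "h3 (mv Red False 1 ?T) = None" by (simp add: app)
    show "h3 (mv Red (\<not> False) 1 ?T) \<noteq> None" if "h3 (mv Red (\<not> False) (-1) ?T) = Some Red"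
      using that H[of 12 12] by (simp add: app pat_def add.commute)
    fix q e assume q: "h3 q = Some Black" "q \<noteq> ?T"
    let ?t = "mv Red e 1 q"
    note b = black[OF q]
    have t: "?t \<in> guards q" by (rule red_target_in_guards)
    have "h ?t \<noteq> None" using b(4) t by (auto simp: guarded_def)
    \<comment> \<open>Such a landing square would lie in row 11, above the only candidate pawn, the
      runner in row 9.\<close>
    moreover have "?t \<noteq> (20 * d + j, 20 * p + 11)" if j: "j \<in> {4, 5, 7, 9, 11, 12, 13}" for j
    proof
      assume tj: "?t = (20 * d + j, 20 * p + 11)"
      then have "q = ?D" using guards_inner[of hv q d j p] b(2,3) t j by auto
      then show False using red_target_le[of e q] tj by simp
    qed
    ultimately show "h3 ?t \<noteq> None" unfolding app by auto
  qed
  have b': "base (Not \<circ> hv) s = base hv (tau s)" for s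
    using base_tau[of hv] by (metis comp_apply tau_tau)
  have "GoodR (Not \<circ> hv) d (h4 \<circ> tau)"
    unfolding GoodR_def Let_def p[symmetric]
  proof (intro conjI allI impI)
    show "(h4 \<circ> tau) (20 * p + 12, 20 * d + 6) = Some Black"
      using H[of 9 9] by (simp add: h4_app pat_def add.commute)
    show "(h4 \<circ> tau) (20 * p + 13, 20 * d + 6) = Some Red"
      using H[of 9 10] by (simp add: h4_app pat_def add.commute)
    show "(h4 \<circ> tau) (20 * p + 14, 20 * d + 6) = None"
      by (simp add: h4_app add.commute)
    show "(h4 \<circ> tau) (20 * p + 12, 20 * d + 8) \<noteq> None"
      using H[of 11 9] by (simp add: h4_app pat_def add.commute)
    show "(h4 \<circ> tau) (20 * p + 14, 20 * d + 7) \<noteq> Some Red"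
      using H[of 10 11] by (simp add: h4_app pat_def add.commute)
    \<comment> \<open>Under \<open>tau\<close> this region becomes rows from
      \<open>20 * p + 12\<close> and columns from \<open>20 * d + 9\<close> on, which avoids row 11
      and the exit column 6.\<close>
    show "(h4 \<circ> tau) (a, b) = base (Not \<circ> hv) (a, b)" if "20 * p + 15 \<le> a" "20 * d + 6 \<le> b" for a b
      using that G'(3)[of "b + 3" "a - 3"] by (auto simp: h4_app b')
    show "lone (h4 \<circ> tau)"
      using G'(6) d0 by (auto simp: lone_def h4_app)
    have guarded: "guarded h4 s" if s: "h4 s = Some Black" and ns: "s \<noteq> ?D" for s
      unfolding guarded_def
    proof
      fix t assume t: "t \<in> guards s"
      have s3: "h3 s = Some Black" "s \<noteq> ?T" using s by (auto simp: h4_def split: if_splits)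
      note b = black[OF s3]
      have "h t \<noteq> None" using b(4) t by (auto simp: guarded_def)
      moreover have "t \<noteq> (20 * d + j, 20 * p + 11)" if j: "j \<in> {4, 5, 7, 9, 11, 12, 13}" for j
        using guards_inner[of hv s d j p] b(2,3) t j ns by auto
      ultimately show "h4 t \<noteq> None" unfolding h4_app by auto
    qed
    show "Safe (Not \<circ> hv) (h4 \<circ> tau) {(20 * p + 12, 20 * d + 6)}"
      unfolding Safe_def
    proof (intro allI impI)
      fix s assume "(h4 \<circ> tau) s = Some Black"
      then have s: "h4 (tau s) = Some Black" by simp
      have s3: "h3 (tau s) = Some Black" "tau s \<noteq> ?T" using s by (auto simp: h4_def split: if_splits)
      have "s = (20 * p + 12, 20 * d + 6)" if "tau s = ?D"
        using that by (simp add: tau_eq_iff)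
      then have "s \<in> {(20 * p + 12, 20 * d + 6)} \<or> guarded (h4 \<circ> tau) s"
        using guarded[OF s] by (auto simp: guarded_tau)
      then show "base (Not \<circ> hv) s = Some Black \<and>
          (s \<in> {(20 * p + 12, 20 * d + 6)} \<or> guarded (h4 \<circ> tau) s)"
        using black[OF s3] b' by simp
    qed
  qed
  then show ?thesis using move reply by blast
qed

text \<open>Any node can be made the root of a play by removing the blocker (6, 11), as if the
  runner of its parent had just passed.\<close>

lemma GoodI_start:
  assumes d: "node d" "hv d"
  shows "GoodI hv d ((base hv)((20 * d + 6, 20 * par d + 11) := None))"
proof -
  \<comment> \<open>The columns -7 and -8 belong to the band with index -1, also after
    mirroring.\<close>
  have "\<not> node (-1)" using par_pos[of "-1"] by auto
  then have lone: "base hv (-7, -10) = Some Red" "base hv (-8, -10) = None" "base hv (-7, -11) = None"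
    by (auto simp: base_def cell_def join_def Let_def)
  have d0: "0 < d" using d par_pos by auto
  have "s = (20 * d + 4, 20 * par d + 11)"
    if "base hv s = Some Black" "(20 * d + 6, 20 * par d + 11) \<in> guards s" for s
    using guards_exit[OF that] .
  then show ?thesis
    using base_guarded[of hv] lone d0 base_gadget[of d hv 6 12] d
    by (auto simp: GoodI_def Let_def Safe_def lone_def guarded_def pat_def)
qed

end

section \<open>Values\<close>

text \<open>The values of rays: the odd finite ordinals and \<open>\<lambda> + 2n\<close> for nonzero limits \<open>\<lambda>\<close>.\<close>

function adm :: "'o::wellorder \<Rightarrow> bool" where
  "adm \<beta> \<longleftrightarrow> (\<exists>\<gamma>. \<gamma> < \<beta>) \<and> (\<forall>\<gamma>. is_succ \<gamma> \<beta> \<longrightarrow> \<not> adm \<gamma>)"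
  by pat_completeness auto
termination by (relation "{(x, y). x < y}") (auto simp: wf is_succ_def)

declare adm.simps [simp del]

lemma is_succ_exists:
  assumes "\<gamma> < (\<beta>::'o::wellorder)"
  obtains \<sigma> where "is_succ \<gamma> \<sigma>" "\<sigma> \<le> \<beta>"
  using assms LeastI[of "\<lambda>x. \<gamma> < x" \<beta>] Least_le[of "\<lambda>x. \<gamma> < x"]
  by (intro that[of "LEAST x. \<gamma> < x"]) (auto simp: is_succ_def)

lemma is_succ_unique: "is_succ \<gamma> \<sigma> \<Longrightarrow> is_succ \<gamma> \<sigma>' \<Longrightarrow> \<sigma> = \<sigma>'"
  by (auto simp: is_succ_def intro: order.antisym)

text \<open>The successor of an \<open>adm\<close> ordinal is not \<open>adm\<close>, so distinct
  \<open>adm\<close> ordinals are at least two steps apart.\<close>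

lemma adm_add_2:
  assumes "adm \<gamma>" "adm \<beta>" "\<gamma> < \<beta>"
  obtains \<sigma> \<tau> where "is_succ \<gamma> \<sigma>" "is_succ \<sigma> \<tau>" "\<tau> \<le> \<beta>"
proof -
  obtain \<sigma> where \<sigma>: "is_succ \<gamma> \<sigma>" "\<sigma> \<le> \<beta>" using is_succ_exists assms(3) by blast
  have "\<sigma> \<noteq> \<beta>" using \<sigma>(1) assms(1,2) adm.simps[of \<beta>] by auto
  then have "\<sigma> < \<beta>" using \<sigma> by simp
  then obtain \<tau> where "is_succ \<sigma> \<tau>" "\<tau> \<le> \<beta>" using is_succ_exists by blast
  then show thesis using that \<sigma> by blast
qed

text \<open>Labels descend, and the children of \<open>n\<close> exhaust all \<open>adm\<close>
  ordinals below \<open>ord n\<close>. The parent of the root is not a node, hence the hypothesis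
  \<open>node (par d)\<close>.\<close>

locale valued_tree = tree_board node par
  for node :: "int \<Rightarrow> bool" and par :: "int \<Rightarrow> int" +
  fixes ord :: "int \<Rightarrow> 'o::wellorder" and H :: "int \<Rightarrow> bool"
  assumes alt: "node d \<Longrightarrow> node (par d) \<Longrightarrow> H d \<noteq> H (par d)"
    and adm_ord: "node n \<Longrightarrow> adm (ord n)"
    and ord_less: "node d \<Longrightarrow> node (par d) \<Longrightarrow> ord d < ord (par d)"
    and child: "node n \<Longrightarrow> \<gamma> < ord n \<Longrightarrow> adm \<gamma> \<Longrightarrow> \<exists>d. node d \<and> par d = n \<and> ord d = \<gamma>"
begin

text \<open>Both moves are forced, and only Red's recapture adds one to the value.\<close>

lemma GoodI_Val:
  assumes "GoodI hv d h" "node d" "hv d" "is_succ \<gamma> \<sigma>"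
    and R: "\<And>h. GoodR (Not \<circ> hv) d h \<Longrightarrow> Val Black h \<gamma>"
  shows "Val Black h \<sigma>"
proof -
  obtain h3 h4 where *: "\<And>h'. gmove h Black h' \<longleftrightarrow> h' = h3" "\<And>h'. gmove h3 Red h' \<longleftrightarrow> h' = h4"
     "GoodR (Not \<circ> hv) d (h4 \<circ> tau)" using GoodI_reply[OF assms(1-3)] by blast
  have "Val Black h4 \<gamma>" using R[OF *(3)] by (simp only: Val_tau)
  then have "Val Red h3 \<sigma>" using Val_succ[of h3 h4 \<gamma> \<sigma>] *(2) assms(4) by blast
  then show ?thesis using Val_Sup[of h h3 \<sigma>] *(1) by auto
qed

text \<open>Induction on the label. The board is mirrored at each level of the tree, which is why
  \<open>hv\<close> ranges over \<open>H\<close> and its negation.\<close>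

lemma GoodR_Val:
  assumes "hv = H \<or> hv = Not \<circ> H" "GoodR hv c h" "node c" "\<not> hv c"
  shows "Val Black h (ord c)"
  using assms
proof (induction "ord c" arbitrary: hv c h rule: less_induct)
  case less
  note G = less.prems(2) and c = less.prems(3,4)
  have exit: "Val Red (hexit c d h) \<tau>"
    if d: "node d" "hv d" "par d = c" and s: "is_succ (ord d) \<sigma>" "is_succ \<sigma> \<tau>" for d \<sigma> \<tau>
  proof -
    obtain h2 where h2: "\<And>h''. gmove (hexit c d h) Red h'' \<longleftrightarrow> h'' = h2" "GoodI hv d h2"
      using hexit_reply[OF G c d] by blast
    have "Val Black h (ord d)" if "GoodR (Not \<circ> hv) d h" for h
    proof (rule less.hyps[OF _ _ that])
      show "ord d < ord c" using ord_less d c by auto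
      show "Not \<circ> hv = H \<or> Not \<circ> hv = Not \<circ> H" using less.prems(1) by (auto simp: Not_comp_Not)
    qed (use d in auto)
    then have "Val Black h2 \<sigma>" by (rule GoodI_Val[OF h2(2) d(1,2) s(1)])
    then show ?thesis using Val_succ[of "hexit c d h" h2 \<sigma> \<tau>] h2(1) s(2) by blast
  qed
  define z where "z = (LEAST x::'o. True)"
  have z: "z \<le> \<gamma>" for \<gamma> unfolding z_def by (rule Least_le) simp
  have "adm (ord c)" using adm_ord c by simp
  then obtain w where "w < ord c" using adm.simps by blast
  then have "z < ord c" using z[of w] by simp
  \<comment> \<open>\<open>z\<close> and \<open>o1\<close> play the roles of 0 and 1.\<close>
  then obtain o1 where o1: "is_succ z o1" "o1 \<le> ord c" using is_succ_exists by blast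
  have inf: "Val Red (hinf c h) o1"
  proof -
    obtain h2 where h2: "gmove (hinf c h) Red h2" "\<And>h3. \<not> gmove h2 Black h3"
      using hinf_reply[OF G c(1)] by blast
    have "Val Black h2 z" using Val_won[OF h2(2) z] .
    then show ?thesis using Val_succ[of "hinf c h" h2 z o1] h2(1) o1(1) z by blast
  qed
  show ?case
  proof (rule Val_Sup)
    show "gmove h Black (hinf c h)" using GoodR_hinf[OF G c] .
  next
    fix h' assume "gmove h Black h'"
    then consider "h' = hinf c h" | d where "node d" "hv d" "par d = c" "h' = hexit c d h"
      using GoodR_moves[OF G c] by blast
    then show "\<exists>\<gamma>\<le>ord c. Val Red h' \<gamma>"
    proof cases
      case 1
      then show ?thesis using inf o1 by blast
    next
      case (2 d)
      have "ord d < ord c" "adm (ord d)" using ord_less adm_ord 2 c by auto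
      then obtain \<sigma> \<tau> where "is_succ (ord d) \<sigma>" "is_succ \<sigma> \<tau>" "\<tau> \<le> ord c"
        using adm_add_2 \<open>adm (ord c)\<close> by blast
      then show ?thesis using exit 2 by blast
    qed
  next
    fix \<delta> assume \<delta>: "\<delta> < ord c"
    have ex: "\<exists>h' \<gamma>'. gmove h Black h' \<and> \<delta> < \<gamma>' \<and> Val Red h' \<gamma>'"
      if \<gamma>: "adm \<gamma>" "\<gamma> < ord c" "\<And>\<sigma> \<tau>. is_succ \<gamma> \<sigma> \<Longrightarrow> is_succ \<sigma> \<tau> \<Longrightarrow> \<delta> < \<tau>" for \<gamma>
    proof -
      obtain d where d: "node d" "par d = c" "ord d = \<gamma>" using child[OF c(1) \<gamma>(2,1)] by blast
      then have "hv d" using alt[of d] less.prems(1) c by auto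
      obtain \<sigma> \<tau> where "is_succ \<gamma> \<sigma>" "is_succ \<sigma> \<tau>"
        using adm_add_2[OF \<gamma>(1) \<open>adm (ord c)\<close> \<gamma>(2)] by blast
      then show ?thesis using \<gamma>(3) exit[of d \<sigma> \<tau>] d \<open>hv d\<close> GoodR_hexit[OF G c, of d] by blast
    qed
    \<comment> \<open>If \<delta> is \<open>adm\<close>, the child labelled \<delta> gives \<delta>
      + 2. Otherwise \<delta> is 0 and the infinite run gives 1, or \<delta> is \<gamma> + 1 with
      \<open>adm \<gamma>\<close> and the child labelled \<gamma> gives \<gamma> + 2.\<close>
    show "\<exists>h' \<gamma>'. gmove h Black h' \<and> \<delta> < \<gamma>' \<and> Val Red h' \<gamma>'"
    proof (cases "adm \<delta>")
      case True
      then show ?thesis using \<delta> by (intro ex[of \<delta>]) (auto simp: is_succ_def)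
    next
      case False
      then consider "\<forall>\<gamma>. \<not> \<gamma> < \<delta>" | \<gamma> where "is_succ \<gamma> \<delta>" "adm \<gamma>"
        using adm.simps[of \<delta>] by blast
      then show ?thesis
      proof cases
        case 1
        then have "\<delta> = z" using z[of \<delta>] by (auto simp: le_less)
        then show ?thesis using inf o1 GoodR_hinf[OF G c] by (auto simp: is_succ_def)
      next
        case (2 \<gamma>)
        then show ?thesis using \<delta> is_succ_unique[of \<gamma>]
          by (intro ex[of \<gamma>]) (auto simp: is_succ_def)
      qed
    qed
  qed
qed

end

section \<open>The tree of descending sequences\<close>

text \<open>Node 1 is the root; the nodes \<open>n \<ge> 2\<close> enumerate the pairs of a parent and a label.\<close>

definition parn :: "nat \<Rightarrow> nat" where
  "parn n = (if n \<le> 1 then 0 else fst (prod_decode (n - 2)) + 1)"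

definition ordn :: "(nat \<Rightarrow> 'o) \<Rightarrow> 'o \<Rightarrow> nat \<Rightarrow> 'o" where
  "ordn e r n = (if n \<le> 1 then r else e (snd (prod_decode (n - 2))))"

lemma parn_less: "0 < n \<Longrightarrow> parn n < n"
proof -
  assume "0 < n"
  \<comment> \<open>A code of a pair is at least its first component; the offset 2 in
    \<open>parn\<close> absorbs the added 1.\<close>
  have "fst (prod_decode m) \<le> m" for m
    using le_prod_encode_1[of "fst (prod_decode m)" "snd (prod_decode m)"] by simp
  from this[of "n - 2"] show ?thesis using \<open>0 < n\<close> by (auto simp: parn_def)
qed

text \<open>Every number from 2 on codes some pair; this selects those whose labels are
  \<open>adm\<close> and descend all the way from the root.\<close>

function nd :: "(nat \<Rightarrow> 'o::wellorder) \<Rightarrow> 'o \<Rightarrow> nat \<Rightarrow> bool" where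
  "nd e r n = (if n \<le> 1 then n = 1
     else nd e r (parn n) \<and> adm (ordn e r n) \<and> ordn e r n < ordn e r (parn n))"
  by pat_completeness auto
termination by (relation "measure (\<lambda>(_, _, n). n)") (auto intro: parn_less)

text \<open>Parity of the depth in the tree, which decides the orientation.\<close>

function dep :: "nat \<Rightarrow> bool" where
  "dep n = (if n \<le> 1 then True else \<not> dep (parn n))"
  by pat_completeness auto
termination by (relation "measure id") (auto intro: parn_less)

declare nd.simps [simp del] dep.simps [simp del]

lemma nd_ord: "nd e r n \<Longrightarrow> ordn e r n \<le> r"
proof (induction n rule: less_induct)
  case (less n)
  then show ?case using nd.simps[of e r n] parn_less[of n]
    by (cases "n = 1") (force simp: ordn_def)+
qed

lemma valued_tree_exists:
  fixes r :: "'o::wellorder" and e :: "nat \<Rightarrow> 'o"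
  assumes "adm r" "\<And>\<gamma>. \<gamma> < r \<Longrightarrow> \<gamma> \<in> range e"
  shows "valued_tree (\<lambda>n. 0 < n \<and> nd e r (nat n)) (\<lambda>n. int (parn (nat n))) (\<lambda>n. ordn e r (nat n))
    (\<lambda>n. dep (nat n))"
proof
  fix n d :: int and \<gamma> :: 'o
  show "0 < n \<and> nd e r (nat n) \<Longrightarrow> 0 \<le> int (parn (nat n))" by simp
  show "0 < n \<and> nd e r (nat n) \<Longrightarrow> int (parn (nat n)) < n" using parn_less[of "nat n"] by simp
  show "0 < n \<and> nd e r (nat n) \<Longrightarrow> adm (ordn e r (nat n))"
    using assms(1) nd.simps[of e r "nat n"] by (auto simp: ordn_def)
  assume d: "0 < d \<and> nd e r (nat d)" "0 < int (parn (nat d)) \<and> nd e r (nat (int (parn (nat d))))"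
  then have 1: "1 < nat d" by (auto simp: parn_def split: if_splits)
  show "dep (nat d) \<noteq> dep (nat (int (parn (nat d))))" using 1 dep.simps[of "nat d"] by auto
  show "ordn e r (nat d) < ordn e r (nat (int (parn (nat d))))"
    using 1 d nd.simps[of e r "nat d"] by auto
next
  fix n :: int and \<gamma> :: 'o
  assume n: "0 < n \<and> nd e r (nat n)" and \<gamma>: "\<gamma> < ordn e r (nat n)" "adm \<gamma>"
  then have "\<gamma> < r" using nd_ord[of e r "nat n"] by simp
  then obtain k where k: "e k = \<gamma>" using assms(2)[of \<gamma>] by auto
  \<comment> \<open>This inverts \<open>parn\<close>: the offset 2 skips the codes 0 and 1, and the
    subtraction undoes the added 1.\<close>
  define m where "m = prod_encode (nat n - 1, k) + 2"
  have "parn m = nat n" "ordn e r m = \<gamma>" "1 < m" using n k by (auto simp: m_def parn_def ordn_def)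
  then show "\<exists>d. (0 < d \<and> nd e r (nat d)) \<and> int (parn (nat d)) = n \<and> ordn e r (nat d) = \<gamma>"
    using n \<gamma> nd.simps[of e r m] by (intro exI[of _ "int m"]) auto
qed

lemma empty_won: "won (brd (\<lambda>_. None), Black)"
  by (auto simp: won_def legal_move_brd gmove_def gcanjump_def gsimple_def)

theorem theorem1:
  fixes \<alpha> :: "'o::wellorder"
  assumes "countable {\<beta>. \<beta> < \<alpha>}"
  shows "\<exists>p. valid_pos p \<and> has_value p \<alpha>"
proof -
  have valid: ?thesis if "has_value (brd h, Black) \<alpha>" for h using that valid_brd by blast
  show ?thesis
  proof (cases "\<exists>\<gamma>. \<gamma> < \<alpha>")
    case False
    then have "\<alpha> \<le> \<gamma>" for \<gamma> by (auto simp: not_less)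
    then show ?thesis using valid has_value_won[OF empty_won] by blast
  next
    case True
    \<comment> \<open>By the recursion for \<open>adm\<close>, a nonzero ordinal that is not
      \<open>adm\<close> is the successor of an \<open>adm\<close> one.\<close>
    define r where "r = (if adm \<alpha> then \<alpha> else (SOME \<gamma>. is_succ \<gamma> \<alpha> \<and> adm \<gamma>))"
    have r: "adm \<alpha> \<and> r = \<alpha> \<or> is_succ r \<alpha> \<and> adm r"
      using True adm.simps[of \<alpha>] someI_ex[of "\<lambda>\<gamma>. is_succ \<gamma> \<alpha> \<and> adm \<gamma>"] by (auto simp: r_def)
    define e where "e = from_nat_into {\<beta>. \<beta> < \<alpha>}"
    have "range e = {\<beta>. \<beta> < \<alpha>}" unfolding e_def using True assms by (intro range_from_nat_into) auto
    then have e: "\<gamma> \<in> range e" if "\<gamma> < r" for \<gamma> using that r by (auto simp: is_succ_def)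
    have "adm r" using r by auto
    interpret valued_tree "\<lambda>n. 0 < n \<and> nd e r (nat n)" "\<lambda>n. int (parn (nat n))" "\<lambda>n. ordn e r (nat n)"
      "\<lambda>n. dep (nat n)"
      using valued_tree_exists[of r e] \<open>adm r\<close> e by blast
    let ?H = "\<lambda>n. dep (nat n)"
    have root: "0 < (1::int) \<and> nd e r (nat 1)" "dep (nat 1)" "ordn e r (nat 1) = r"
      using nd.simps[of e r 1] dep.simps[of 1] by (auto simp: ordn_def)
    obtain h where h: "GoodI ?H 1 h" using GoodI_start[of 1 ?H] root by blast
    have R: "Val Black h r" if "GoodR (Not \<circ> ?H) 1 h" for h
      using GoodR_Val[of "Not \<circ> ?H" 1 h] that root by simp
    from r show ?thesis
    proof
      assume "adm \<alpha> \<and> r = \<alpha>"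
      \<comment> \<open>The wanted position arises after the first two forced moves, when the runner
        of the root has been released.\<close>
      then show ?thesis using GoodI_reply[OF h root(1,2)] R valid by (auto simp: Val_def)
    next
      assume "is_succ r \<alpha> \<and> adm r"
      \<comment> \<open>Here the starting position itself serves: the recapture of the root's relay
        pawn supplies the extra 1.\<close>
      then show ?thesis using GoodI_Val[OF h root(1,2) _ R] valid by (auto simp: Val_def)
    qed
  qed
qed

end
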